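(* Let $d\in\mathbb{N}$, $\beta\in(0,1)$, $p\in(0,\infty]$ and $\alpha\in(0,\infty)$, let $\boldsymbol{\ell}:\mathbb{N}\to\mathbb{N}_{\ge 2}\cup\{\infty\}$ and $\boldsymbol{c}:\mathbb{N}\to\mathbb{N}\cup\{\infty\}$ be non-decreasing, and suppose that $\gamma^\ast(\boldsymbol{\ell},\boldsymbol{c})<\infty$. If $$\alpha>\frac{\beta+\frac{d}{p}}{1-\beta}\cdot\gamma^\ast(\boldsymbol{\ell},\boldsymbol{c}),$$ then $A^{\alpha,p}_{\boldsymbol{\ell},\boldsymbol{c}}([0,1]^d)\hookrightarrow C^{0,\beta}([0,1]^d)$.
   Context: $\mathbb{N}=\{1,2,3,\dots\}$. Convention: $d/p:=0$ if $p=\infty$. Neural networks: a neural network is a tuple $\Phi=((A_1,b_1),\dots,(A_L,b_L))$ with $L\in\mathbb{N}$, $A_j\in\mathbb{R}^{N_j\times N_{j-1}}$, $b_j\in\mathbb{R}^{N_j}$, $N_0,\dots,N_L\in\mathbb{N}$. Put $L(\Phi):=L$ (number of layers), $d_{\mathrm{in}}(\Phi):=N_0$, $d_{\mathrm{out}}(\Phi):=N_L$, $W(\Phi):=\sum_{j=1}^L(\|A_j\|_{\ell^0}+\|b_j\|_{\ell^0})$, where $\|\cdot\|_{\ell^0}$ counts non-zero entries, and $\|\Phi\|_{\mathcal{NN}}:=\max_j\max\{\|A_j\|_\infty,\|b_j\|_\infty\}$, where $\|\cdot\|_\infty$ is the largest absolute value of an entry. With the ReLU $\varrho(x)=\max\{0,x\}$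 acting componentwise and $T_jx=A_jx+b_j$, the realization is $R_\varrho\Phi:=T_L\circ(\varrho\circ T_{L-1})\circ\cdots\circ(\varrho\circ T_1):\mathbb{R}^{N_0}\to\mathbb{R}^{N_L}$. Approximation spaces: $\Sigma_n^{\boldsymbol{\ell},\boldsymbol{c}}$ is the set of all $R_\varrho\Phi$ with $d_{\mathrm{in}}(\Phi)=d$, $d_{\mathrm{out}}(\Phi)=1$, $W(\Phi)\le n$, $L(\Phi)\le\boldsymbol{\ell}(n)$, $\|\Phi\|_{\mathcal{NN}}\le\boldsymbol{c}(n)$. For measurable $f:[0,1]^d\to\mathbb{R}$ let $d_p(f,\Sigma):=\inf_{g\in\Sigma}\|f-g\|_{L^p([0,1]^d)}$ and $$\Gamma_{\alpha,p}(f):=\max\Big\{\|f\|_{L^p([0,1]^d)},\ \sup_{n\in\mathbb{N}}\big[n^\alpha\cdot d_p(f,\Sigma_n^{\boldsymbol{\ell},\boldsymbol{c}})\big]\Big\}\in[0,\infty],$$ $\|f\|_{A^{\alpha,p}_{\boldsymbol{\ell},\boldsymbol{c}}}:=\inf\{t>0:\Gamma_{\alpha,p}(f/t)\le1\}\in[0,\infty]$, and $A^{\alpha,p}_{\boldsymbol{\ell},\boldsymbol{c}}([0,1]^d):=\{f\in L^p([0,1]^d):\|f\|_{A^{\alpha,p}_{\boldsymbol{\ell},\boldsymbol{c}}}<\infty\}$ (a quasi-normed space). Complexity exponent: with $\boldsymbol{\ell}^\ast:=\sup_{n\in\mathbb{N}}\boldsymbol{\ell}(n)$ and $\mathbb{N}_{\le\boldsymbol{\ell}^\ast}:=\{L\in\mathbb{N}:L\le\boldsymbol{\ell}^\ast\}$,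 $$\gamma^\ast(\boldsymbol{\ell},\boldsymbol{c}):=\sup\Big\{\gamma\in[0,\infty):\exists\,L\in\mathbb{N}_{\le\boldsymbol{\ell}^\ast}:\ \limsup_{n\to\infty}\frac{(\boldsymbol{c}(n))^L\cdot n^{\lfloor L/2\rfloor}}{n^\gamma}\in(0,\infty]\Big\}.$$ Hölder spaces: $\operatorname{Lip}_\beta(f):=\sup_{x\ne y\in[0,1]^d}\frac{|f(x)-f(y)|}{\|x-y\|_{\ell^\infty}^\beta}$, and $C^{0,\beta}([0,1]^d)$ consists of all $f:[0,1]^d\to\mathbb{R}$ with $\|f\|_{C^{0,\beta}}:=\|f\|_{L^\infty}+\operatorname{Lip}_\beta(f)<\infty$. An embedding $X\hookrightarrow Y$ means that every $f\in X$ belongs to $Y$ (after possibly changing $f$ on a null set) and there is $C>0$ with $\|f\|_Y\le C\|f\|_X$ for all $f\in X$. *)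

theory Defs
  imports
    "HOL-Probability.Essential_Supremum"
    "Jordan_Normal_Form.Matrix"
begin

text \<open>Jordan_Normal_Form shares several names with HOL-Analysis: vectors of the fixed space
  \<open>real^'d\<close> come from the latter, the layers of a network (whose dimensions vary) from the
  former, written with the qualifier \<open>Matrix\<close> below.\<close>

no_notation Finite_Cartesian_Product.vec_nth (infixl \<open>$\<close> 90)


subsection \<open>ReLU networks\<close>

type_synonym net = "(real mat \<times> real Matrix.vec) list"

text \<open>Layers are numbered from 0, i.e. \<open>\<Phi> ! j\<close> is the \<open>(j + 1)\<close>-st layer and \<open>N j\<close> is its
  input dimension.\<close>

definition is_net :: "net \<Rightarrow> bool" where
  "is_net \<Phi> \<longleftrightarrow> \<Phi> \<noteq> [] \<and>
     (\<exists>N :: nat \<Rightarrow> nat. (\<forall>j\<le>length \<Phi>. 1 \<le> N j) \<and>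
        (\<forall>j<length \<Phi>. fst (\<Phi> ! j) \<in> carrier_mat (N (Suc j)) (N j) \<and>
                        snd (\<Phi> ! j) \<in> carrier_vec (N (Suc j))))"

definition d_in :: "net \<Rightarrow> nat" where
  "d_in \<Phi> = dim_col (fst (hd \<Phi>))"

definition d_out :: "net \<Rightarrow> nat" where
  "d_out \<Phi> = dim_row (fst (last \<Phi>))"

definition l0_mat :: "real mat \<Rightarrow> nat" where
  "l0_mat A = card {(i, j). i < dim_row A \<and> j < dim_col A \<and> A $$ (i, j) \<noteq> 0}"

definition l0_vec :: "real Matrix.vec \<Rightarrow> nat" where
  "l0_vec b = card {i. i < dim_vec b \<and> b $ i \<noteq> 0}"

definition num_weights :: "net \<Rightarrow> nat" where
  "num_weights \<Phi> = (\<Sum>(A, b)\<leftarrow>\<Phi>. l0_mat A + l0_vec b)"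

definition linf_mat :: "real mat \<Rightarrow> real" where
  "linf_mat A = Max (abs ` elements_mat A)"

definition linf_vec :: "real Matrix.vec \<Rightarrow> real" where
  "linf_vec b = Max (abs ` set\<^sub>v b)"

definition net_norm :: "net \<Rightarrow> real" where
  "net_norm \<Phi> = Max ((\<lambda>(A, b). max (linf_mat A) (linf_vec b)) ` set \<Phi>)"

definition relu :: "real \<Rightarrow> real" where
  "relu x = max 0 x"

text \<open>The equation for the empty list is never used, since networks are nonempty.\<close>

fun realization :: "net \<Rightarrow> real Matrix.vec \<Rightarrow> real Matrix.vec" where
  "realization [] x = x"
| "realization [(A, b)] x = A *\<^sub>v x + b"
| "realization ((A, b) # l # \<Phi>) x = realization (l # \<Phi>) (map_vec relu (A *\<^sub>v x + b))"

text \<open>The coordinates of \<open>real^'d\<close> are numbered by the library bijection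
  \<open>from_nat_into UNIV\<close> from \<open>{..<CARD('d)}\<close> onto \<open>UNIV\<close>. The set
  \<open>net_class \<l> c n\<close> below does not depend on the numbering, because
  permuting the columns of the first matrix of a network changes neither the number of nonzero
  entries nor their size.\<close>

definition coords :: "real^'d \<Rightarrow> real Matrix.vec" where
  "coords x = Matrix.vec CARD('d) (\<lambda>i. Finite_Cartesian_Product.vec_nth x (from_nat_into UNIV i))"

definition net_class ::
    "(nat \<Rightarrow> enat) \<Rightarrow> (nat \<Rightarrow> enat) \<Rightarrow> nat \<Rightarrow> (real^'d \<Rightarrow> real) set" where
  "net_class \<l> c n =
     {\<lambda>x. realization \<Phi> (coords x) $ 0 | \<Phi>.
        is_net \<Phi> \<and> d_in \<Phi> = CARD('d) \<and> d_out \<Phi> = 1 \<and>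
        num_weights \<Phi> \<le> n \<and> enat (length \<Phi>) \<le> \<l> n \<and>
        ennreal (net_norm \<Phi>) \<le> ennreal_of_enat (c n)}"


subsection \<open>Lebesgue quasi-norms on the unit cube\<close>

definition cube :: "(real^'d) measure" where
  "cube = lebesgue_on (cbox 0 1)"

definition ennreal_powr :: "ennreal \<Rightarrow> real \<Rightarrow> ennreal" where
  "ennreal_powr x r = (if x = \<infinity> then \<infinity> else ennreal (enn2real x powr r))"

definition Lp_norm :: "ennreal \<Rightarrow> (real^'d \<Rightarrow> real) \<Rightarrow> ennreal" where
  "Lp_norm p f =
     (if p = \<infinity> then esssup cube (\<lambda>x. ennreal \<bar>f x\<bar>)
      else ennreal_powr (\<integral>\<^sup>+x. ennreal (\<bar>f x\<bar> powr enn2real p) \<partial>cube) (1 / enn2real p))"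

definition Lp_space :: "ennreal \<Rightarrow> (real^'d \<Rightarrow> real) set" where
  "Lp_space p = {f \<in> borel_measurable cube. Lp_norm p f < \<infinity>}"

definition Lp_dist :: "ennreal \<Rightarrow> (real^'d \<Rightarrow> real) \<Rightarrow> (real^'d \<Rightarrow> real) set \<Rightarrow> ennreal" where
  "Lp_dist p f S = (INF g\<in>S. Lp_norm p (\<lambda>x. f x - g x))"


subsection \<open>Approximation spaces and the complexity exponent\<close>

text \<open>The index \<open>n\<close> ranges over the positive integers: the values at 0 of the sequences
  \<open>\<l>\<close> and \<open>c\<close> play no role.\<close>

definition approx_gamma ::
    "(nat \<Rightarrow> enat) \<Rightarrow> (nat \<Rightarrow> enat) \<Rightarrow> real \<Rightarrow> ennreal \<Rightarrow> (real^'d \<Rightarrow> real) \<Rightarrow> ennreal" where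
  "approx_gamma \<l> c \<alpha> p f =
     max (Lp_norm p f)
         (SUP n\<in>{1..}. ennreal (real n powr \<alpha>) * Lp_dist p f (net_class \<l> c n))"

definition approx_norm ::
    "(nat \<Rightarrow> enat) \<Rightarrow> (nat \<Rightarrow> enat) \<Rightarrow> real \<Rightarrow> ennreal \<Rightarrow> (real^'d \<Rightarrow> real) \<Rightarrow> ennreal" where
  "approx_norm \<l> c \<alpha> p f =
     (INF t\<in>{t::real. 0 < t \<and> approx_gamma \<l> c \<alpha> p (\<lambda>x. f x / t) \<le> 1}. ennreal t)"

definition approx_space ::
    "(nat \<Rightarrow> enat) \<Rightarrow> (nat \<Rightarrow> enat) \<Rightarrow> real \<Rightarrow> ennreal \<Rightarrow> (real^'d \<Rightarrow> real) set" where
  "approx_space \<l> c \<alpha> p = {f \<in> Lp_space p. approx_norm \<l> c \<alpha> p f < \<infinity>}"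

definition depth_sup :: "(nat \<Rightarrow> enat) \<Rightarrow> enat" where
  "depth_sup \<l> = (SUP n\<in>{1..}. \<l> n)"

definition gamma_star :: "(nat \<Rightarrow> enat) \<Rightarrow> (nat \<Rightarrow> enat) \<Rightarrow> ennreal" where
  "gamma_star \<l> c =
     (SUP \<gamma>\<in>{\<gamma>::real. 0 \<le> \<gamma> \<and> (\<exists>L::nat. 1 \<le> L \<and> enat L \<le> depth_sup \<l> \<and>
          limsup (\<lambda>n. ennreal_of_enat (c n) ^ L * of_nat n ^ (L div 2) / ennreal (real n powr \<gamma>))
            > 0)}. ennreal \<gamma>)"


subsection \<open>Hoelder spaces and embeddings\<close>

definition Lip :: "real \<Rightarrow> (real^'d \<Rightarrow> real) \<Rightarrow> ennreal" where
  "Lip \<beta> f = (SUP (x, y)\<in>{(x, y). x \<in> cbox 0 1 \<and> y \<in> cbox 0 1 \<and> x \<noteq> y}.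
                ennreal (\<bar>f x - f y\<bar> / infnorm (x - y) powr \<beta>))"

definition holder_norm :: "real \<Rightarrow> (real^'d \<Rightarrow> real) \<Rightarrow> ennreal" where
  "holder_norm \<beta> f = Lp_norm \<infinity> f + Lip \<beta> f"

definition holder_space :: "real \<Rightarrow> (real^'d \<Rightarrow> real) set" where
  "holder_space \<beta> = {f. holder_norm \<beta> f < \<infinity>}"

definition embeds ::
    "(real^'d \<Rightarrow> real) set \<Rightarrow> ((real^'d \<Rightarrow> real) \<Rightarrow> ennreal) \<Rightarrow>
     (real^'d \<Rightarrow> real) set \<Rightarrow> ((real^'d \<Rightarrow> real) \<Rightarrow> ennreal) \<Rightarrow> bool" where
  "embeds X normX Y normY \<longleftrightarrow>
     (\<exists>C::real. 0 < C \<and>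
        (\<forall>f\<in>X. \<exists>g\<in>Y. (AE x in cube. g x = f x) \<and> normY g \<le> ennreal C * normX f))"

end

theory Submission
  imports Defs
begin

text \<open>Every \<open>g\<close> in \<open>net_class \<l> c n\<close> has Lipschitz constant at most
  \<open>K n\<^sup>\<gamma>\<close> as soon as \<open>\<gamma> > \<gamma>\<^sup>*\<close>. An \<open>f\<close> in the
  unit ball is approximated in \<open>L\<^sup>p\<close> by \<open>F k\<close> with \<open>2\<^sup>k\<close> weights
  and error \<open>\<lesssim> 2 powr (- \<alpha> k)\<close>. By Markov's inequality, each cube of side
  \<open>r = 2 powr (- \<rho> k)\<close> contains a point at which \<open>F (k + 1) - F k\<close> is
  \<open>\<lesssim> 2 powr (- \<alpha> k) r powr (- d / p)\<close>, and the Lipschitz bound spreads this to the whole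
  cube at the price of \<open>2 powr (\<gamma> k) r\<close>. Playing the sup bound against the Lipschitz bound,
  the \<open>\<beta>\<close>-Hoelder seminorms of the differences decay geometrically if
  \<open>\<gamma> / (1 - \<beta>) < \<rho> < \<alpha> / (\<beta> + d / p)\<close>; such a \<open>\<rho>\<close> exists
  precisely because of the assumption on \<open>\<alpha>\<close>. Markov's inequality also covers \<open>p < 1\<close>,
  so no (quasi-)triangle inequality in \<open>L\<^sup>p\<close> is needed.\<close>

subsection \<open>Lipschitz constants of networks\<close>

lemma relu_lip: "\<bar>relu x - relu y\<bar> \<le> \<bar>x - y\<bar>" 
  by (simp add: relu_def)

lemma affine_diff:
  fixes A :: "real mat"
  assumes "A \<in> carrier_mat nr nc" "b \<in> carrier_vec nr" "x \<in> carrier_vec nc" "y \<in> carrier_vec nc"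
    and "i < nr"
  shows "(A *\<^sub>v x + b) $ i - (A *\<^sub>v y + b) $ i = (\<Sum>j<nc. A $$ (i, j) * (x $ j - y $ j))"
  using assms
  by (simp add: scalar_prod_def lessThan_atLeast0 algebra_simps flip: sum_subtractf)

text \<open>Hoelder's inequality in each row: only the size of the entries of \<open>A\<close>
  enters, not their number, so this direction is free of the weight count.\<close>

lemma affine_l1_linf:
  fixes A :: "real mat"
  assumes "A \<in> carrier_mat nr nc" "b \<in> carrier_vec nr" "x \<in> carrier_vec nc" "y \<in> carrier_vec nc"
    and "i < nr" and A: "\<And>i j. i < nr \<Longrightarrow> j < nc \<Longrightarrow> \<bar>A $$ (i, j)\<bar> \<le> c"
    and s: "(\<Sum>j<nc. \<bar>x $ j - y $ j\<bar>) \<le> s" and "0 \<le> c"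
  shows "\<bar>(A *\<^sub>v x + b) $ i - (A *\<^sub>v y + b) $ i\<bar> \<le> c * s"
proof -
  have "\<bar>\<Sum>j<nc. A $$ (i, j) * (x $ j - y $ j)\<bar> \<le> (\<Sum>j<nc. c * \<bar>x $ j - y $ j\<bar>)"
    by (rule order_trans[OF sum_abs sum_mono])
      (auto simp: abs_mult intro!: mult_right_mono A \<open>i < nr\<close>)
  also have "\<dots> \<le> c * s"
    using s \<open>0 \<le> c\<close> by (simp add: mult_left_mono flip: sum_distrib_left)
  finally show ?thesis
    by (subst affine_diff[OF assms(1-5)])
qed

text \<open>Summed over all rows, every nonzero entry of \<open>A\<close> is charged once, at most
  \<open>c * s\<close>. Thus the number of nonzero entries replaces the dimensions of the layer,
  which a bound on the weights does not control.\<close>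

lemma affine_linf_l1:
  fixes A :: "real mat"
  assumes "A \<in> carrier_mat nr nc" "b \<in> carrier_vec nr" "x \<in> carrier_vec nc" "y \<in> carrier_vec nc"
    and A: "\<And>i j. i < nr \<Longrightarrow> j < nc \<Longrightarrow> \<bar>A $$ (i, j)\<bar> \<le> c"
    and s: "\<And>j. j < nc \<Longrightarrow> \<bar>x $ j - y $ j\<bar> \<le> s" and "0 \<le> c" "0 \<le> s"
  shows "(\<Sum>i<nr. \<bar>(A *\<^sub>v x + b) $ i - (A *\<^sub>v y + b) $ i\<bar>) \<le> c * l0_mat A * s"
proof -
  let ?N = "{(i, j). i < nr \<and> j < nc \<and> A $$ (i, j) \<noteq> 0}"
  have "(\<Sum>i<nr. \<bar>(A *\<^sub>v x + b) $ i - (A *\<^sub>v y + b) $ i\<bar>)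
      \<le> (\<Sum>i<nr. \<Sum>j<nc. \<bar>A $$ (i, j) * (x $ j - y $ j)\<bar>)"
    by (intro sum_mono) (simp add: affine_diff[OF assms(1-4)] sum_abs)
  also have "\<dots> = (\<Sum>(i, j)\<in>{..<nr} \<times> {..<nc}. \<bar>A $$ (i, j) * (x $ j - y $ j)\<bar>)"
    by (simp add: sum.cartesian_product)
  also have "\<dots> = (\<Sum>(i, j)\<in>?N. \<bar>A $$ (i, j) * (x $ j - y $ j)\<bar>)"
    by (rule sum.mono_neutral_right) auto
  also have "\<dots> \<le> (\<Sum>(i, j)\<in>?N. c * s)"
    by (rule sum_mono) (auto simp: abs_mult intro!: mult_mono A s \<open>0 \<le> c\<close>)
  also have "\<dots> = c * l0_mat A * s"
    using assms(1) by (simp add: l0_mat_def case_prod_unfold)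
  finally show ?thesis .
qed

lemma net_norm_entry:
  assumes "net_norm \<Phi> \<le> c" "(A, b) \<in> set \<Phi>" "i < dim_row A" "j < dim_col A"
  shows "\<bar>A $$ (i, j)\<bar> \<le> c"
proof -
  have "\<bar>A $$ (i, j)\<bar> \<le> linf_mat A"
    unfolding linf_mat_def using assms
    by (intro Max_ge imageI elements_matI[of A _ _ i j]) (auto simp: elements_mat_def)
  also have "linf_mat A \<le> max (linf_mat A) (linf_vec b)"
    by simp
  also have "\<dots> \<le> net_norm \<Phi>"
    unfolding net_norm_def using assms(2) by (intro Max_ge) force+
  finally show ?thesis
    using assms(1) by simp
qed

text \<open>Peels off the first layer for the induction over the list of layers; the tail has the
  shifted dimension sequence \<open>\<lambda>j. N (Suc j)\<close>.\<close>

lemma is_net_Cons: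
  assumes "is_net ((A, b) # \<Phi>)"
  shows "b \<in> carrier_vec (dim_row A)"
    and "\<Phi> \<noteq> [] \<Longrightarrow> is_net \<Phi> \<and> d_in \<Phi> = dim_row A"
proof -
  obtain N where N: "\<forall>j\<le>length ((A, b) # \<Phi>). 1 \<le> N j"
    and *: "\<forall>j<length ((A, b) # \<Phi>). fst (((A, b) # \<Phi>) ! j) \<in> carrier_mat (N (Suc j)) (N j) \<and>
                        snd (((A, b) # \<Phi>) ! j) \<in> carrier_vec (N (Suc j))"
    using assms unfolding is_net_def by blast
  have A: "A \<in> carrier_mat (N 1) (N 0)" "b \<in> carrier_vec (N 1)"
    using spec[OF *, of 0] by auto
  then show "b \<in> carrier_vec (dim_row A)"
    by auto
  assume "\<Phi> \<noteq> []"
  moreover have "\<forall>j\<le>length \<Phi>. 1 \<le> N (Suc j)"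
    using N by auto
  moreover have **: "\<forall>j<length \<Phi>. fst (\<Phi> ! j) \<in> carrier_mat (N (Suc (Suc j))) (N (Suc j)) \<and>
                        snd (\<Phi> ! j) \<in> carrier_vec (N (Suc (Suc j)))"
    using * by (metis Suc_less_eq length_Cons nth_Cons_Suc)
  ultimately have "is_net \<Phi>"
    unfolding is_net_def by (auto intro!: exI[of _ "\<lambda>j. N (Suc j)"])
  moreover have "d_in \<Phi> = dim_row A"
    using A(1) spec[OF **, of 0] \<open>\<Phi> \<noteq> []\<close> by (auto simp: d_in_def hd_conv_nth)
  ultimately show "is_net \<Phi> \<and> d_in \<Phi> = dim_row A" ..
qed

text \<open>The factor \<open>n\<close> is paid only in every second layer: a layer costs \<open>c\<close> from
  \<open>l\<^sup>1\<close> to \<open>l\<^sup>\<infinity>\<close> and \<open>c n\<close> from \<open>l\<^sup>\<infinity>\<close> to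
  \<open>l\<^sup>1\<close>. The two conjuncts are the two norms on the input.\<close>

lemma realization_lipschitz:
  assumes "is_net \<Phi>" "d_out \<Phi> = 1" "num_weights \<Phi> \<le> n"
    and c: "\<And>A b i j. (A, b) \<in> set \<Phi> \<Longrightarrow> i < dim_row A \<Longrightarrow> j < dim_col A \<Longrightarrow> \<bar>A $$ (i, j)\<bar> \<le> c"
    and "0 \<le> c" "0 \<le> s" "x \<in> carrier_vec (d_in \<Phi>)" "y \<in> carrier_vec (d_in \<Phi>)"
  shows "((\<Sum>j<d_in \<Phi>. \<bar>x $ j - y $ j\<bar>) \<le> s \<longrightarrow>
           \<bar>realization \<Phi> x $ 0 - realization \<Phi> y $ 0\<bar> \<le> c ^ length \<Phi> * n ^ (length \<Phi> div 2) * s)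
       \<and> ((\<forall>j<d_in \<Phi>. \<bar>x $ j - y $ j\<bar> \<le> s) \<longrightarrow>
           \<bar>realization \<Phi> x $ 0 - realization \<Phi> y $ 0\<bar> \<le> c ^ length \<Phi> * n ^ (Suc (length \<Phi>) div 2) * s)"
  using assms
proof (induction \<Phi> arbitrary: x y s)
  case Nil
  then show ?case by (simp add: is_net_def)
next
  case (Cons l \<Phi>)
  obtain A b where l: "l = (A, b)" by fastforce
  have A: "A \<in> carrier_mat (dim_row A) (d_in (l # \<Phi>))"
    by (auto simp: d_in_def l)
  have b: "b \<in> carrier_vec (dim_row A)"
    using is_net_Cons Cons.prems(1) l by blast
  have Ac: "\<bar>A $$ (i, j)\<bar> \<le> c" if "i < dim_row A" "j < d_in (l # \<Phi>)" for i j
    using that Cons.prems(4)[of A b i j] by (auto simp: l d_in_def)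
  have w: "l0_mat A \<le> n" "num_weights \<Phi> \<le> n"
    using Cons.prems(3) by (auto simp: l num_weights_def)
  let ?u = "A *\<^sub>v x + b" and ?v = "A *\<^sub>v y + b"
  have 1: "\<bar>?u $ i - ?v $ i\<bar> \<le> c * s"
    if "(\<Sum>j<d_in (l # \<Phi>). \<bar>x $ j - y $ j\<bar>) \<le> s" "i < dim_row A" for i
    using affine_l1_linf[OF A b Cons.prems(7,8) that(2) Ac that(1) \<open>0 \<le> c\<close>] .
  have 2: "(\<Sum>i<dim_row A. \<bar>?u $ i - ?v $ i\<bar>) \<le> c * n * s"
    if "\<forall>j<d_in (l # \<Phi>). \<bar>x $ j - y $ j\<bar> \<le> s"
  proof -
    have "(\<Sum>i<dim_row A. \<bar>?u $ i - ?v $ i\<bar>) \<le> c * l0_mat A * s"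
      using that by (intro affine_linf_l1[OF A b Cons.prems(7,8) Ac _ \<open>0 \<le> c\<close> \<open>0 \<le> s\<close>]) auto
    also have "\<dots> \<le> c * n * s"
      using w(1) \<open>0 \<le> c\<close> \<open>0 \<le> s\<close> by (intro mult_right_mono mult_left_mono) auto
    finally show ?thesis .
  qed
  show ?case
  proof (cases \<Phi>)
    case Nil
    \<comment> \<open>With one output row, the sum in \<open>2\<close> is the single distance at
      index 0, so \<open>1\<close> and \<open>2\<close> are the two claims for depth one.\<close>
    have [simp]: "dim_row A = 1"
      using Cons.prems(2) by (simp add: d_out_def l Nil)
    show ?thesis
      using 1[of 0] 2 by (simp add: l Nil del: index_add_vec index_mult_mat_vec)
  next
    case (Cons l' \<Phi>')
    let ?x = "map_vec relu ?u" and ?y = "map_vec relu ?v"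
    have net: "is_net \<Phi>" "d_in \<Phi> = dim_row A"
      using is_net_Cons(2)[OF Cons.prems(1)[unfolded l]] Cons by auto
    have out: "d_out \<Phi> = 1"
      using Cons.prems(2) by (simp add: d_out_def Cons)
    have R: "realization (l # \<Phi>) x = realization \<Phi> ?x" "realization (l # \<Phi>) y = realization \<Phi> ?y"
      by (simp_all add: l Cons)
    have car: "?x \<in> carrier_vec (d_in \<Phi>)" "?y \<in> carrier_vec (d_in \<Phi>)"
      unfolding net using b by (auto intro!: carrier_vecI)
    have le: "\<bar>?x $ i - ?y $ i\<bar> \<le> \<bar>?u $ i - ?v $ i\<bar>" if "i < dim_row A" for i
      using b that relu_lip[of "?u $ i" "?v $ i"] by (simp del: index_add_vec(1) index_mult_mat_vec)
    \<comment> \<open>The two conjuncts feed each other: an l1 bound \<open>s\<close> on the input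
      becomes the sup bound \<open>t = c * s\<close> after the layer, and a sup bound
      \<open>s\<close> becomes the l1 bound \<open>t = c * n * s\<close>.\<close>
    have IH: "((\<Sum>j<d_in \<Phi>. \<bar>?x $ j - ?y $ j\<bar>) \<le> t \<longrightarrow>
           \<bar>realization \<Phi> ?x $ 0 - realization \<Phi> ?y $ 0\<bar> \<le> c ^ length \<Phi> * n ^ (length \<Phi> div 2) * t)
       \<and> ((\<forall>j<d_in \<Phi>. \<bar>?x $ j - ?y $ j\<bar> \<le> t) \<longrightarrow>
           \<bar>realization \<Phi> ?x $ 0 - realization \<Phi> ?y $ 0\<bar> \<le> c ^ length \<Phi> * n ^ (Suc (length \<Phi>) div 2) * t)"
      if "0 \<le> t" for t
      using Cons.prems(4) by (intro Cons.IH net out w(2) that car \<open>0 \<le> c\<close>) auto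
    show ?thesis
    proof (intro conjI impI)
      assume *: "(\<Sum>j<d_in (l # \<Phi>). \<bar>x $ j - y $ j\<bar>) \<le> s"
      have "\<forall>j<d_in \<Phi>. \<bar>?x $ j - ?y $ j\<bar> \<le> c * s"
        using order_trans[OF le 1[OF *]] unfolding net by blast
      with IH[of "c * s"] show "\<bar>realization (l # \<Phi>) x $ 0 - realization (l # \<Phi>) y $ 0\<bar>
          \<le> c ^ length (l # \<Phi>) * n ^ (length (l # \<Phi>) div 2) * s"
        using \<open>0 \<le> c\<close> \<open>0 \<le> s\<close> unfolding R by (simp add: mult_ac)
    next
      assume *: "\<forall>j<d_in (l # \<Phi>). \<bar>x $ j - y $ j\<bar> \<le> s"
      have "(\<Sum>j<d_in \<Phi>. \<bar>?x $ j - ?y $ j\<bar>) \<le> (\<Sum>j<d_in \<Phi>. \<bar>?u $ j - ?v $ j\<bar>)"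
        using le by (intro sum_mono) (simp only: net lessThan_iff)
      also have "\<dots> \<le> c * n * s"
        using 2[OF *] unfolding net .
      finally show "\<bar>realization (l # \<Phi>) x $ 0 - realization (l # \<Phi>) y $ 0\<bar>
          \<le> c ^ length (l # \<Phi>) * n ^ (Suc (length (l # \<Phi>)) div 2) * s"
        using IH[of "c * n * s"] \<open>0 \<le> c\<close> \<open>0 \<le> s\<close> unfolding R by (simp add: mult_ac)
    qed
  qed
qed

text \<open>Passing from the sup norm to the l1 norm already at the input costs only
  \<open>CARD('d)\<close>. This gives the exponent \<open>L div 2\<close>, the one in
  \<open>gamma_star\<close>, instead of \<open>Suc L div 2\<close>.\<close>

lemma net_class_lipschitz:
  fixes g :: "real^'d \<Rightarrow> real"
  assumes "g \<in> net_class \<l> c n" "c n = enat m" "\<l> n \<le> enat L" "1 \<le> n" "1 \<le> m"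
  shows "\<bar>g x - g y\<bar> \<le> real m ^ L * real n ^ (L div 2) * (CARD('d) * infnorm (x - y))"
proof -
  let ?s = "CARD('d) * infnorm (x - y)"
  obtain \<Phi> where g: "g = (\<lambda>x. realization \<Phi> (coords x) $ 0)"
    and \<Phi>: "is_net \<Phi>" "d_in \<Phi> = CARD('d)" "d_out \<Phi> = 1" "num_weights \<Phi> \<le> n"
      "enat (length \<Phi>) \<le> \<l> n" "ennreal (net_norm \<Phi>) \<le> ennreal_of_enat (c n)"
    using assms(1) unfolding net_class_def by blast
  have nm: "net_norm \<Phi> \<le> m"
    using \<Phi>(6) by (simp add: assms(2) ennreal_of_nat_eq_real_of_nat)
  have len: "length \<Phi> \<le> L"
    using order_trans[OF \<Phi>(5) assms(3)] by simp
  have "\<bar>coords x $ j - coords y $ j\<bar> \<le> infnorm (x - y)" if "j < CARD('d)" for j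
    using that component_le_infnorm_cart[of "x - y" "from_nat_into UNIV j"] by (simp add: coords_def)
  then have "(\<Sum>j<d_in \<Phi>. \<bar>coords x $ j - coords y $ j\<bar>) \<le> ?s"
    using sum_bounded_above[of "{..<CARD('d)}" _ "infnorm (x - y)"] by (simp add: \<Phi>(2))
  moreover have "coords x \<in> carrier_vec (d_in \<Phi>)" "coords y \<in> carrier_vec (d_in \<Phi>)"
    by (simp_all add: coords_def \<Phi>(2))
  ultimately have "\<bar>g x - g y\<bar> \<le> real m ^ length \<Phi> * real n ^ (length \<Phi> div 2) * ?s"
    using realization_lipschitz[OF \<Phi>(1,3,4) net_norm_entry[OF nm], where s = ?s and x = "coords x" and y = "coords y"]
    by (simp add: g infnorm_pos_le)
  \<comment> \<open>Both bases are at least 1, so the actual depth may be replaced by the upper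
    bound \<open>L\<close>.\<close>
  also have "\<dots> \<le> real m ^ L * real n ^ (L div 2) * ?s"
    using assms(4,5) len
    by (intro mult_right_mono mult_mono power_increasing) (auto simp: infnorm_pos_le div_le_mono)
  finally show ?thesis .
qed

section \<open>Consequences of a finite complexity exponent\<close>

lemma gamma_star_ge:
  assumes "0 \<le> \<gamma>" "1 \<le> L" "enat L \<le> depth_sup \<l>"
    and "eventually (\<lambda>n. 1 \<le> ennreal_of_enat (c n) ^ L * of_nat n ^ (L div 2) / ennreal (real n powr \<gamma>)) sequentially"
  shows "ennreal \<gamma> \<le> gamma_star \<l> c"
proof -
  have "0 < (1 :: ennreal)"
    by simp
  also have "1 \<le> limsup (\<lambda>n. ennreal_of_enat (c n) ^ L * of_nat n ^ (L div 2) / ennreal (real n powr \<gamma>))"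
    by (rule le_Limsup[OF _ assms(4)]) simp
  finally have "0 < limsup (\<lambda>n. ennreal_of_enat (c n) ^ L * of_nat n ^ (L div 2) / ennreal (real n powr \<gamma>))" .
  then show ?thesis
    unfolding gamma_star_def using assms(1-3) by (intro SUP_upper) blast
qed

text \<open>An infinite value of \<open>c\<close> persists by monotonicity. Already for
  \<open>L = 1\<close> the quotient would then be infinite for all large arguments and every
  \<gamma>, so \<open>gamma_star\<close> would exceed every real number.\<close>

lemma gamma_star_finite_width:
  assumes "gamma_star \<l> c < \<infinity>" "mono_on {1..} c" "\<And>n. 1 \<le> n \<Longrightarrow> 2 \<le> \<l> n" "1 \<le> n"
  shows "c n \<noteq> \<infinity>"
proof
  assume "c n = \<infinity>"
  then have inf: "c k = \<infinity>" if "n \<le> k" for k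
    using mono_onD[OF assms(2), of n k] that assms(4) by simp
  have "2 \<le> depth_sup \<l>"
    unfolding depth_sup_def using assms(3)[of 1] by (intro SUP_upper2[of 1]) auto
  then have d: "enat 1 \<le> depth_sup \<l>"
    using order_trans[of "enat 1" 2] by (simp add: numeral_eq_enat)
  have *: "ennreal \<gamma> \<le> gamma_star \<l> c" if "0 \<le> \<gamma>" for \<gamma>
    by (rule gamma_star_ge[OF that _ d])
      (auto simp: inf ennreal_top_divide intro!: eventually_sequentiallyI[of n])
  obtain r where "gamma_star \<l> c = ennreal r" "0 \<le> r"
    using assms(1) by (cases "gamma_star \<l> c") auto
  with *[of "r + 1"] show False
    by (simp del: ennreal_plus)
qed

text \<open>Unbounded depth admits \<open>L = 2 * k\<close> for every \<open>k\<close>. The factor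
  \<open>n ^ k\<close> then cancels against \<open>real n powr real k\<close>, and since
  \<open>c\<close> is at least 1, \<open>gamma_star\<close> would be at least every
  \<open>k\<close>.\<close>

lemma gamma_star_finite_depth:
  assumes "gamma_star \<l> c < \<infinity>" "\<And>n. 1 \<le> n \<Longrightarrow> 1 \<le> c n"
  shows "depth_sup \<l> \<noteq> \<infinity>"
proof
  assume inf: "depth_sup \<l> = \<infinity>"
  have *: "ennreal (real k) \<le> gamma_star \<l> c" if k: "1 \<le> k" for k
  proof (rule gamma_star_ge[of _ "2 * k"])
    show "\<forall>\<^sub>F n in sequentially. 1 \<le> ennreal_of_enat (c n) ^ (2 * k) * of_nat n ^ (2 * k div 2)
        / ennreal (real n powr real k)"
    proof (rule eventually_sequentiallyI[of 1])
      fix n :: nat assume n: "1 \<le> n"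
      have "1 \<le> ennreal_of_enat (c n)"
        using assms(2)[OF n] ennreal_of_enat_le_iff[of 1 "c n"] by simp
      then have "1 \<le> ennreal_of_enat (c n) ^ (2 * k)"
        by (intro one_le_power)
      also have "\<dots> = ennreal_of_enat (c n) ^ (2 * k) * (of_nat n ^ k / ennreal (real n powr real k))"
        using n by (simp add: powr_realpow ennreal_of_nat_eq_real_of_nat ennreal_power)
      also have "\<dots> = ennreal_of_enat (c n) ^ (2 * k) * of_nat n ^ (2 * k div 2)
          / ennreal (real n powr real k)"
        by (simp add: ennreal_times_divide)
      finally show "1 \<le> ennreal_of_enat (c n) ^ (2 * k) * of_nat n ^ (2 * k div 2)
          / ennreal (real n powr real k)" .
    qed
  qed (use k inf in auto)
  obtain r where r: "gamma_star \<l> c = ennreal r" "0 \<le> r"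
    using assms(1) by (cases "gamma_star \<l> c") auto
  obtain k :: nat where "r < k"
    using reals_Archimedean2 by blast
  with *[of k] r show False
    by (cases "k = 0") auto
qed

text \<open>Depth is bounded by one finite \<open>L\<close>, and for this \<open>L\<close> the
  growth quotient is below 1 for all large \<open>n\<close> because \<gamma> lies above
  \<open>gamma_star\<close>. The remaining finitely many \<open>n\<close> are absorbed into the
  constant.\<close>

lemma net_class_uniform_lipschitz:
  fixes \<l> c :: "nat \<Rightarrow> enat" 
  assumes \<l>: "\<And>n. 1 \<le> n \<Longrightarrow> 2 \<le> \<l> n"
    and c: "\<And>n. 1 \<le> n \<Longrightarrow> 1 \<le> c n" "mono_on {1..} c"
    and \<gamma>: "gamma_star \<l> c < ennreal \<gamma>" "0 \<le> \<gamma>"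
  obtains K where "0 < K"
    "\<And>n (g :: real^'d \<Rightarrow> real) x y. 1 \<le> n \<Longrightarrow> g \<in> net_class \<l> c n \<Longrightarrow>
       \<bar>g x - g y\<bar> \<le> K * real n powr \<gamma> * infnorm (x - y)"
proof -
  have fin: "gamma_star \<l> c < \<infinity>"
    using \<gamma>(1) by (metis ennreal_less_top infinity_ennreal_def less_trans)
  obtain L where L: "depth_sup \<l> = enat L"
    using gamma_star_finite_depth[OF fin c(1)] by auto
  have "2 \<le> depth_sup \<l>"
    unfolding depth_sup_def using \<l>[of 1] by (intro SUP_upper2[of 1]) auto
  then have L2: "2 \<le> L"
    by (simp add: L numeral_eq_enat)
  define m where "m = (\<lambda>n. the_enat (c n))"
  have m: "c n = enat (m n)" if "1 \<le> n" for n
    using gamma_star_finite_width[OF fin c(2) \<l> that] by (auto simp: m_def)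
  have m1: "1 \<le> m n" if "1 \<le> n" for n
    using c(1)[OF that] m[OF that] by (simp add: one_enat_def)
  have \<l>L: "\<l> n \<le> enat L" if "1 \<le> n" for n
    using that unfolding L[symmetric] depth_sup_def by (intro SUP_upper) auto
  let ?X = "\<lambda>n. ennreal_of_enat (c n) ^ L * of_nat n ^ (L div 2) / ennreal (real n powr \<gamma>)"
  \<comment> \<open>Otherwise \<gamma> would belong to the set whose supremum is
    \<open>gamma_star\<close>, with the maximal depth \<open>L\<close> as witness.\<close>
  have "\<not> 0 < limsup ?X"
  proof
    assume "0 < limsup ?X"
    then have "ennreal \<gamma> \<le> gamma_star \<l> c"
      unfolding gamma_star_def using \<gamma>(2) L2 by (intro SUP_upper) (auto simp: L intro!: exI[of _ L])
    then show False using \<gamma>(1) by simp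
  qed
  then have "limsup ?X < 1"
    by (simp add: not_less)
  from Limsup_lessD[OF this] obtain N where N: "\<And>n. N \<le> n \<Longrightarrow> ?X n < 1"
    unfolding eventually_sequentially by blast
  define N' where "N' = max 1 N"
  have X: "real (m n) ^ L * real n ^ (L div 2) \<le> real n powr \<gamma>" if "N' \<le> n" for n
  proof -
    have n: "1 \<le> n" "N \<le> n" using that by (auto simp: N'_def)
    then have "?X n = ennreal (real (m n) ^ L * real n ^ (L div 2) / real n powr \<gamma>)"
      by (simp add: m ennreal_of_nat_eq_real_of_nat ennreal_power divide_ennreal flip: ennreal_mult)
    with N[OF n(2)] have "real (m n) ^ L * real n ^ (L div 2) / real n powr \<gamma> < 1"
      by simp
    then show ?thesis using n by (simp add: field_simps)
  qed
  \<comment> \<open>By monotonicity the value at \<open>N'\<close> dominates all earlier ones; it is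
    at least 1, so the same constant serves the arguments beyond \<open>N'\<close>.\<close>
  define B where "B = real (m N') ^ L * real N' ^ (L div 2)"
  have B: "1 \<le> B"
    unfolding B_def by (intro mult_ge1_I one_le_power) (use m1[of N'] in \<open>auto simp: N'_def\<close>)
  have *: "real (m n) ^ L * real n ^ (L div 2) \<le> B * real n powr \<gamma>" if n: "1 \<le> n" for n
  proof (cases "N' \<le> n")
    case True
    then have "real (m n) ^ L * real n ^ (L div 2) \<le> 1 * real n powr \<gamma>"
      using X by simp
    also have "\<dots> \<le> B * real n powr \<gamma>"
      using B by (intro mult_right_mono) auto
    finally show ?thesis .
  next
    case False
    then have "m n \<le> m N'"
      using mono_onD[OF c(2), of n N'] n m[of n] m[of N'] by simp
    then have "real (m n) ^ L * real n ^ (L div 2) \<le> B * 1"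
      unfolding B_def using False by (auto intro!: mult_mono power_mono)
    also have "\<dots> \<le> B * real n powr \<gamma>"
      using B n \<gamma>(2) by (intro mult_left_mono ge_one_powr_ge_zero) auto
    finally show ?thesis .
  qed
  show ?thesis
  proof (rule that[of "B * CARD('d)"])
    show "0 < B * CARD('d)" using B by simp
    fix n and g :: "real^'d \<Rightarrow> real" and x y
    assume n: "1 \<le> n" and g: "g \<in> net_class \<l> c n"
    show "\<bar>g x - g y\<bar> \<le> B * CARD('d) * real n powr \<gamma> * infnorm (x - y)"
      using order_trans[OF net_class_lipschitz[OF g m[OF n] \<l>L[OF n] n m1[OF n], of x y] mult_right_mono[OF *[OF n]]]
      by (simp add: mult_ac infnorm_pos_le)
  qed
qed

subsection \<open>Sampling in small cubes\<close>

lemma space_cube [simp]: "space cube = cbox 0 1"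
  by (simp add: cube_def)

lemma finite_measure_cube: "finite_measure (cube :: (real^'d) measure)"
  unfolding cube_def by (rule finite_measure_lebesgue_on) simp

lemma cbox_in_sets_cube:
  assumes "cbox a b \<subseteq> cbox 0 (1 :: real^'d)"
  shows "cbox a b \<in> sets cube" "measure cube (cbox a b) = measure lborel (cbox a b)"
proof -
  show "cbox a b \<in> sets cube"
    unfolding cube_def using assms by (subst sets_restrict_space_iff) auto
  show "measure cube (cbox a b) = measure lborel (cbox a b)"
    unfolding cube_def using assms by (subst measure_restrict_space) auto
qed

lemma borel_measurable_cube_continuous:
  fixes g :: "real^'d \<Rightarrow> real"
  assumes "continuous_on UNIV g"
  shows "g \<in> borel_measurable cube"
  unfolding cube_def
  by (rule continuous_imp_measurable_on_sets_lebesgue) (auto intro: continuous_on_subset assms)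

lemma infnorm_lipschitz_continuous:
  fixes g :: "real^'d \<Rightarrow> real"
  assumes "\<And>x y. \<bar>g x - g y\<bar> \<le> M * infnorm (x - y)"
  shows "continuous_on UNIV g"
\<comment> \<open>The sign of \<open>M\<close> is not given, whereas \<open>lipschitz_on\<close>
  asks for a nonnegative constant.\<close>
proof (rule lipschitz_on_continuous_on[of "\<bar>M\<bar>"], rule lipschitz_onI)
  fix x y :: "real^'d"
  have "\<bar>g x - g y\<bar> \<le> \<bar>M\<bar> * infnorm (x - y)"
    using assms[of x y] mult_right_mono[OF abs_ge_self[of M] infnorm_pos_le[of "x - y"]] by linarith
  also have "\<dots> \<le> \<bar>M\<bar> * norm (x - y)"
    by (intro mult_left_mono infnorm_le_norm) auto
  finally show "dist (g x) (g y) \<le> \<bar>M\<bar> * dist x y"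
    by (simp add: dist_norm)
qed simp

text \<open>The image of the unit cube under the homothety with centre \<open>x\<close> and ratio
  \<open>r\<close> has side \<open>r\<close>, contains \<open>x\<close>, and stays inside by
  convexity, even when \<open>x\<close> is on the boundary.\<close>

lemma subcube_near:
  fixes x :: "real^'d"
  assumes x: "x \<in> cbox 0 1" and r: "0 < r" "r \<le> 1"
  obtains Q where "Q \<in> sets cube" "measure cube Q = r ^ CARD('d)" "Q \<subseteq> cbox 0 1"
    "\<And>y. y \<in> Q \<Longrightarrow> infnorm (y - x) \<le> r"
proof
  let ?a = "(1 - r) *\<^sub>R x" and ?b = "(1 - r) *\<^sub>R x + r *\<^sub>R 1"
  have x01: "0 \<le> vec_nth x i" "vec_nth x i \<le> 1" for i
    using x by (auto simp: mem_box_cart)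
  have b: "(1 - r) * vec_nth x i + r \<le> 1" for i
    using mult_left_mono[OF x01(2)[of i], of "1 - r"] r by simp
  have a: "0 \<le> (1 - r) * vec_nth x i" for i
    using x01(1)[of i] r by simp
  have "?a \<in> cbox ?a ?b"
    using r by (auto simp: mem_box_cart)
  then have ne: "cbox ?a ?b \<noteq> {}" by blast
  show sub: "cbox ?a ?b \<subseteq> cbox 0 1"
  proof
    fix y assume "y \<in> cbox ?a ?b"
    then have y: "(1 - r) * vec_nth x i \<le> vec_nth y i" "vec_nth y i \<le> (1 - r) * vec_nth x i + r" for i
      by (auto simp: mem_box_cart)
    have "0 \<le> vec_nth y i" "vec_nth y i \<le> 1" for i
      using order_trans[OF a y(1)] order_trans[OF y(2) b] .
    then show "y \<in> cbox 0 1"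
      by (simp add: mem_box_cart)
  qed
  show "cbox ?a ?b \<in> sets cube"
    by (rule cbox_in_sets_cube[OF sub])
  show "measure cube (cbox ?a ?b) = r ^ CARD('d)"
    using cbox_in_sets_cube(2)[OF sub] ne by (simp add: content_cbox_cart)
  fix y assume y: "y \<in> cbox ?a ?b"
  have "\<bar>vec_nth y i - vec_nth x i\<bar> \<le> r" for i
  proof -
    have "0 \<le> r * vec_nth x i" "r * vec_nth x i \<le> r * 1"
      using x01[of i] r by (auto intro: mult_left_mono)
    moreover have "(1 - r) * vec_nth x i \<le> vec_nth y i" "vec_nth y i \<le> (1 - r) * vec_nth x i + r"
      using y by (auto simp: mem_box_cart)
    ultimately show ?thesis
      by (simp add: algebra_simps)
  qed
  then show "infnorm (y - x) \<le> r"
    unfolding infnorm_cart by (intro cSup_least) auto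
qed

text \<open>Two sets, each filling less than half of the volume of a subcube, cannot cover it. Two
  are allowed so that a point can be good for two consecutive approximants at once.\<close>

lemma good_point_near:
  fixes x :: "real^'d"
  assumes "x \<in> cbox 0 1" "0 < r" "r \<le> 1"
    and "A \<in> sets cube" "measure cube A < r ^ CARD('d) / 2"
    and "B \<in> sets cube" "measure cube B < r ^ CARD('d) / 2"
  obtains y where "y \<in> cbox 0 1" "y \<notin> A" "y \<notin> B" "infnorm (y - x) \<le> r"
proof -
  interpret finite_measure "cube :: (real^'d) measure"
    by (rule finite_measure_cube)
  obtain Q where Q: "Q \<in> sets cube" "measure cube Q = r ^ CARD('d)" "Q \<subseteq> cbox 0 1"
    "\<And>y. y \<in> Q \<Longrightarrow> infnorm (y - x) \<le> r"
    using subcube_near[OF assms(1-3)] by blast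
  have "\<not> Q \<subseteq> A \<union> B"
  proof
    assume "Q \<subseteq> A \<union> B"
    then have "measure cube Q \<le> measure cube (A \<union> B)"
      using assms by (intro finite_measure_mono) auto
    also have "\<dots> \<le> measure cube A + measure cube B"
      using assms by (intro measure_Un_le) auto
    finally show False
      using assms Q(2) by simp
  qed
  then show ?thesis
    using that Q(3,4) by blast
qed

lemma measurable_gt_cube:
  fixes h :: "real^'d \<Rightarrow> real"
  assumes "h \<in> borel_measurable cube"
  shows "{x \<in> cbox 0 1. t < \<bar>h x\<bar>} \<in> sets cube"
proof -
  have "{x \<in> space cube. t < \<bar>h x\<bar>} \<in> sets cube"
    using assms by measurable
  then show ?thesis by simp
qed

text \<open>Markov's inequality for the \<open>p\<close>-th power of \<open>\<bar>h\<bar>\<close>.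
  The threshold carries the power of \<open>r\<close> that makes the exceptional set less than half
  of a cube of side \<open>r\<close>.\<close>

lemma Lp_norm_Markov:
  fixes p :: ennreal
  assumes "0 < p"
  obtains K where "0 < K"
    "\<And>(h :: real^'d \<Rightarrow> real) \<epsilon> r. h \<in> borel_measurable cube \<Longrightarrow> Lp_norm p h \<le> ennreal \<epsilon> \<Longrightarrow>
      0 < \<epsilon> \<Longrightarrow> 0 < r \<Longrightarrow> r \<le> 1 \<Longrightarrow>
      measure cube {x \<in> cbox 0 1. K * \<epsilon> * r powr - (CARD('d) / enn2real p) < \<bar>h x\<bar>} < r ^ CARD('d) / 2"
proof (cases "p = \<infinity>")
  case True
  show ?thesis
  proof (rule that[of 1])
    fix h :: "real^'d \<Rightarrow> real" and \<epsilon> r :: real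
    assume h: "h \<in> borel_measurable cube" "Lp_norm p h \<le> ennreal \<epsilon>" and \<epsilon>: "0 < \<epsilon>" "0 < r"
    have "AE x in cube. ennreal \<bar>h x\<bar> \<le> ennreal \<epsilon>"
      using esssup_AE[of "\<lambda>x. ennreal \<bar>h x\<bar>" cube] h(2) True
      by (auto simp: Lp_norm_def elim: order_trans)
    then have "AE x in cube. \<not> \<epsilon> < \<bar>h x\<bar>"
      using \<epsilon> by (simp add: not_less)
    then have "{x \<in> cbox 0 1. \<epsilon> < \<bar>h x\<bar>} \<in> null_sets cube"
      using measurable_gt_cube[OF h(1)] by (subst (asm) AE_iff_null) auto
    \<comment> \<open>Here \<open>enn2real p = 0\<close> and division by zero gives 0, so the power
      of \<open>r\<close> is 1 and the threshold is \<epsilon> itself.\<close>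
    then show "measure cube {x \<in> cbox 0 1. 1 * \<epsilon> * r powr - (CARD('d) / enn2real p) < \<bar>h x\<bar>} < r ^ CARD('d) / 2"
      using True \<epsilon> by (simp add: measure_def null_sets_def)
  qed simp
next
  case False
  define P where "P = enn2real p"
  have P: "0 < P"
    using assms False by (cases p) (auto simp: P_def)
  show ?thesis
  \<comment> \<open>With the factor 3, Markov's inequality yields \<open>r ^ CARD('d) / 3\<close>,
    strictly below the required half.\<close>
  proof (rule that[of "3 powr (1 / P)"])
    fix h :: "real^'d \<Rightarrow> real" and \<epsilon> r :: real
    assume h: "h \<in> borel_measurable cube" "Lp_norm p h \<le> ennreal \<epsilon>" and \<epsilon>: "0 < \<epsilon>" "0 < r" "r \<le> 1"
    define I where "I = (\<integral>\<^sup>+x. ennreal (\<bar>h x\<bar> powr P) \<partial>cube)"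
    have N: "ennreal_powr I (1 / P) \<le> ennreal \<epsilon>"
      using h(2) False by (simp add: Lp_norm_def I_def P_def)
    then obtain i where i: "I = ennreal i" "0 \<le> i"
      by (cases I) (auto simp: ennreal_powr_def top_unique)
    with N \<epsilon> have "i powr (1 / P) \<le> \<epsilon>"
      by (simp add: ennreal_powr_def)
    then have "(i powr (1 / P)) powr P \<le> \<epsilon> powr P"
      using P by (intro powr_mono2) auto
    then have i\<epsilon>: "i \<le> \<epsilon> powr P"
      using P i by (simp add: powr_powr)
    have um: "(\<lambda>x. ennreal (\<bar>h x\<bar> powr P)) \<in> borel_measurable cube"
      using h(1) by measurable
    define t where "t = 3 powr (1 / P) * \<epsilon> * r powr - (CARD('d) / P)"
    have t: "0 < t"
      using \<epsilon> by (simp add: t_def)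
    have tP: "t powr P = 3 * \<epsilon> powr P / r ^ CARD('d)"
    proof -
      have "(r powr - (CARD('d) / P)) powr P = 1 / r ^ CARD('d)"
        using \<epsilon> P by (subst powr_powr) (simp add: powr_minus_divide powr_realpow)
      moreover have "(3 powr (1 / P)) powr P = 3"
        using P by (simp add: powr_powr)
      ultimately show ?thesis
        using \<epsilon> by (simp add: t_def powr_mult)
    qed
    have "{x \<in> cbox 0 1. t < \<bar>h x\<bar>} \<subseteq> {x \<in> space cube. 1 \<le> ennreal (1 / t powr P) * ennreal (\<bar>h x\<bar> powr P)}"
    proof safe
      fix x assume "t < \<bar>h x\<bar>"
      then have "t powr P \<le> \<bar>h x\<bar> powr P"
        using t P by (intro powr_mono2) auto
      then show "1 \<le> ennreal (1 / t powr P) * ennreal (\<bar>h x\<bar> powr P)"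
        using t by (simp flip: ennreal_mult)
    qed simp
    then have "emeasure cube {x \<in> cbox 0 1. t < \<bar>h x\<bar>} \<le>
        emeasure cube {x \<in> space cube. 1 \<le> ennreal (1 / t powr P) * ennreal (\<bar>h x\<bar> powr P)}"
      using h(1) by (intro emeasure_mono) measurable
    also have "\<dots> \<le> ennreal (1 / t powr P) * (\<integral>\<^sup>+x. ennreal (\<bar>h x\<bar> powr P) * indicator (space cube) x \<partial>cube)"
      using h(1) by (intro nn_integral_Markov_inequality borel_measurable_times_ennreal um
          borel_measurable_indicator sets.top)
    also have "(\<integral>\<^sup>+x. ennreal (\<bar>h x\<bar> powr P) * indicator (space cube) x \<partial>cube) = I"
      unfolding I_def by (rule nn_integral_cong) auto
    also have "ennreal (1 / t powr P) * I = ennreal (i / t powr P)"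
      using i by (simp flip: ennreal_mult)
    finally have "measure cube {x \<in> cbox 0 1. t < \<bar>h x\<bar>} \<le> i / t powr P"
      using i by (simp add: measure_def enn2real_leI)
    also have "\<dots> \<le> \<epsilon> powr P / t powr P"
      by (intro divide_right_mono i\<epsilon>) simp
    also have "\<dots> < r ^ CARD('d) / 2"
      unfolding tP using \<epsilon> by (simp add: field_simps)
    finally show "measure cube {x \<in> cbox 0 1. 3 powr (1 / P) * \<epsilon> * r powr - (CARD('d) / enn2real p) < \<bar>h x\<bar>} < r ^ CARD('d) / 2"
      by (simp add: t_def P_def)
  qed simp
qed

subsection \<open>Multiscale limits\<close>

text \<open>Interpolation: the slope bound handles \<open>h \<le> r\<close>, the sup bound handles
  \<open>h > r\<close>. The signs of \<open>\<beta> - 1\<close> and \<beta> allow \<open>r\<close>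
  to be replaced by \<open>h\<close> in each case, so the result is independent of the
  scale.\<close>

lemma multiscale_holder:
  fixes h r \<beta> D :: real
  assumes "0 < \<beta>" "\<beta> < 1" "0 < r" "0 \<le> h" "0 \<le> B"
    and "D \<le> B * r powr (\<beta> - 1) * h" "D \<le> 2 * (B * r powr \<beta>)"
  shows "D \<le> 2 * B * h powr \<beta>"
proof (cases "h \<le> r")
  case True
  show ?thesis
  \<comment> \<open>Since \<open>0 powr (\<beta> - 1) = 0\<close>, the antitone comparison of powers
    fails at 0, where the slope bound gives the claim directly.\<close>
  proof (cases "h = 0")
    case True
    then show ?thesis using assms by simp
  next
    case False
    have "r powr (\<beta> - 1) * h \<le> h powr (\<beta> - 1) * h"
      using True False assms by (intro mult_right_mono powr_mono2') auto
    also have "\<dots> = h powr \<beta>"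
      using False assms powr_mult_base[of h "\<beta> - 1"] by (simp add: mult.commute)
    finally have "B * (r powr (\<beta> - 1) * h) \<le> B * h powr \<beta>"
      using assms by (intro mult_left_mono)
    moreover have "0 \<le> B * h powr \<beta>"
      using assms by simp
    ultimately show ?thesis using assms(6) by (simp add: mult_ac)
  qed
next
  case False
  then have "B * r powr \<beta> \<le> B * h powr \<beta>"
    using assms by (intro mult_left_mono powr_mono2) auto
  with assms(7) show ?thesis by simp
qed

text \<open>At level \<open>k\<close> the sampling cubes have side \<open>\<sigma> ^ k\<close>; the
  powers of this side are the natural \<beta>-Hoelder scaling of slope and error. The surplus
  \<open>q ^ k\<close> makes the telescoping series converge. The function \<open>f\<close> enters
  only through measures of exceptional sets.\<close>

lemma multiscale_limit:
  fixes f :: "real^'d \<Rightarrow> real" and F :: "nat \<Rightarrow> real^'d \<Rightarrow> real"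
  assumes \<beta>: "0 < \<beta>" "\<beta> < 1" and q: "0 < q" "q < 1" and \<sigma>: "0 < \<sigma>" "\<sigma> < 1" and "0 \<le> C"
    and f: "f \<in> borel_measurable cube"
    and lip: "\<And>k x y. \<bar>F k x - F k y\<bar> \<le> C * (\<sigma> ^ k) powr (\<beta> - 1) * q ^ k * infnorm (x - y)"
    and close: "\<And>k. measure cube {x \<in> cbox 0 1. C * (\<sigma> ^ k) powr \<beta> * q ^ k < \<bar>f x - F k x\<bar>}
      < (\<sigma> ^ k) ^ CARD('d) / 2"
    and bounded: "measure cube {x \<in> cbox 0 1. C < \<bar>f x\<bar>} < 1 / 2"
  obtains g where "g \<in> borel_measurable cube" "AE x in cube. g x = f x"
    "\<And>x. x \<in> cbox 0 1 \<Longrightarrow> \<bar>g x\<bar> \<le> C * (3 + (2 + 2 / \<sigma>) / (1 - q))"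
    "\<And>x y. x \<in> cbox 0 1 \<Longrightarrow> y \<in> cbox 0 1 \<Longrightarrow>
      \<bar>g x - g y\<bar> \<le> C * (1 + (4 + 4 / \<sigma>) / (1 - q)) * infnorm (x - y) powr \<beta>"
proof -
  interpret finite_measure "cube :: (real^'d) measure"
    by (rule finite_measure_cube)
  \<comment> \<open>Large enough for both \<open>C * (1 + 1 / \<sigma>)\<close> in the slope bound
    and \<open>C * (3 + 1 / \<sigma>)\<close> in the sup bound of the differences, because
    \<open>1 \<le> 1 / \<sigma>\<close>.\<close>
  define B where "B = C * (2 + 2 / \<sigma>)"
  have B: "0 \<le> B"
    using \<open>0 \<le> C\<close> \<sigma> by (simp add: B_def)
  have inv: "1 \<le> 1 / \<sigma>" "2 / \<sigma> = 2 * (1 / \<sigma>)"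
    using \<sigma> by auto
  have F_meas: "F k \<in> borel_measurable cube" for k
    by (rule borel_measurable_cube_continuous[OF infnorm_lipschitz_continuous[OF lip]])
  define bad where "bad k = {x \<in> cbox 0 1. C * (\<sigma> ^ k) powr \<beta> * q ^ k < \<bar>f x - F k x\<bar>}" for k
  have bad_sets: "bad k \<in> sets cube" for k
    unfolding bad_def using f F_meas by (intro measurable_gt_cube) auto
  define G where "G k x = F (Suc k) x - F k x" for k x

  have \<sigma>1: "(\<sigma> ^ k) powr s \<le> 1" if "0 \<le> s" for k s
    using that \<sigma> by (intro powr_le1) (auto simp: power_le_one)
  have Suc_\<beta>: "(\<sigma> ^ Suc k) powr \<beta> \<le> (\<sigma> ^ k) powr \<beta>" for k
    using \<sigma> \<beta> by (intro powr_mono2) (auto simp: mult_le_cancel_right2)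
  have q_Suc: "q ^ Suc k \<le> q ^ k" for k
    using q by (simp add: mult_le_cancel_right2)
  have Suc_slope: "(\<sigma> ^ Suc k) powr (\<beta> - 1) \<le> (\<sigma> ^ k) powr (\<beta> - 1) / \<sigma>" for k
  proof -
    have "(\<sigma> ^ Suc k) powr (\<beta> - 1) = \<sigma> powr (\<beta> - 1) * (\<sigma> ^ k) powr (\<beta> - 1)"
      using \<sigma> by (simp add: powr_mult)
    also have "\<dots> \<le> \<sigma> powr (- 1) * (\<sigma> ^ k) powr (\<beta> - 1)"
      using \<sigma> \<beta> by (intro mult_right_mono powr_mono') auto
    finally show ?thesis
      using \<sigma> by (simp add: powr_minus divide_simps)
  qed
  have slope_scale: "(\<sigma> ^ k) powr (\<beta> - 1) * \<sigma> ^ k = (\<sigma> ^ k) powr \<beta>" for k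
    using \<sigma> powr_mult_base[of "\<sigma> ^ k" "\<beta> - 1"] by (simp add: mult.commute)

  \<comment> \<open>Estimates for consecutive differences\<close>
  have G_lip: "\<bar>G k x - G k y\<bar> \<le> (C * (1 + 1 / \<sigma>)) * (\<sigma> ^ k) powr (\<beta> - 1) * q ^ k * infnorm (x - y)" for k x y
  proof -
    have "\<bar>F (Suc k) x - F (Suc k) y\<bar> \<le> C * ((\<sigma> ^ k) powr (\<beta> - 1) / \<sigma>) * q ^ k * infnorm (x - y)"
      using \<open>0 \<le> C\<close> q \<sigma> Suc_slope[of k] q_Suc[of k]
      by (intro order_trans[OF lip] mult_right_mono mult_mono mult_left_mono)
        (auto simp: infnorm_pos_le mult_le_cancel_right2)
    with lip[of k x y] show ?thesis
      by (simp add: G_def algebra_simps)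
  qed
  have G_sup: "\<bar>G k x\<bar> \<le> B * (\<sigma> ^ k) powr \<beta> * q ^ k" if x: "x \<in> cbox 0 1" for k x
  proof -
    have s: "0 < \<sigma> ^ k" "\<sigma> ^ k \<le> 1"
      using \<sigma> by (auto simp: power_le_one)
    have 1: "measure cube (bad k) < (\<sigma> ^ k) ^ CARD('d) / 2"
      using close by (simp add: bad_def)
    have "measure cube (bad (Suc k)) < (\<sigma> ^ Suc k) ^ CARD('d) / 2"
      using close unfolding bad_def .
    also have "\<dots> \<le> (\<sigma> ^ k) ^ CARD('d) / 2"
      using \<sigma> by (intro divide_right_mono power_mono) (auto simp: mult_le_cancel_right2)
    \<comment> \<open>At such a \<open>y\<close> both approximants are close to \<open>f\<close>,
      hence to each other; the Lipschitz bound carries this over the distance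
      \<open>\<sigma> ^ k\<close> to \<open>x\<close>. The coarser side \<open>\<sigma> ^ k\<close>
      is used for both exceptional sets.\<close>
    finally obtain y where y: "y \<in> cbox 0 1" "y \<notin> bad k" "y \<notin> bad (Suc k)" "infnorm (y - x) \<le> \<sigma> ^ k"
      using good_point_near[OF x s bad_sets 1 bad_sets] by blast
    have "\<bar>f y - F (Suc k) y\<bar> \<le> C * (\<sigma> ^ Suc k) powr \<beta> * q ^ Suc k"
      using y by (auto simp: bad_def)
    also have "\<dots> \<le> C * (\<sigma> ^ k) powr \<beta> * q ^ k"
      using \<open>0 \<le> C\<close> q by (intro mult_mono mult_left_mono Suc_\<beta> q_Suc) auto
    finally have "\<bar>G k y\<bar> \<le> 2 * (C * (\<sigma> ^ k) powr \<beta> * q ^ k)"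
      using y(1,2) by (auto simp: bad_def G_def)
    moreover have "\<bar>G k y - G k x\<bar> \<le> C * (1 + 1 / \<sigma>) * (\<sigma> ^ k) powr (\<beta> - 1) * q ^ k * \<sigma> ^ k"
      using \<open>0 \<le> C\<close> q \<sigma> y(4) by (intro order_trans[OF G_lip] mult_left_mono) auto
    ultimately have "\<bar>G k x\<bar> \<le> 2 * (C * (\<sigma> ^ k) powr \<beta> * q ^ k) +
        C * (1 + 1 / \<sigma>) * q ^ k * ((\<sigma> ^ k) powr (\<beta> - 1) * \<sigma> ^ k)"
      by (simp add: mult_ac)
    also have "\<dots> = C * (3 + 1 / \<sigma>) * (\<sigma> ^ k) powr \<beta> * q ^ k"
      unfolding slope_scale by (simp add: algebra_simps)
    also have "\<dots> \<le> B * (\<sigma> ^ k) powr \<beta> * q ^ k"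
    proof -
      have "C * (3 + 1 / \<sigma>) \<le> B"
      unfolding B_def inv(2) using inv(1) \<open>0 \<le> C\<close> by (intro mult_left_mono) linarith+
      then show ?thesis
        using q by (intro mult_right_mono) auto
    qed
    finally show ?thesis .
  qed
  have G_sup': "\<bar>G k x\<bar> \<le> B * q ^ k" if "x \<in> cbox 0 1" for k x
  proof -
    have "B * (\<sigma> ^ k) powr \<beta> * q ^ k \<le> B * 1 * q ^ k"
      using B q \<beta> by (intro mult_right_mono mult_left_mono \<sigma>1) auto
    with G_sup[OF that, of k] show ?thesis by simp
  qed
  have G_holder: "\<bar>G k x - G k y\<bar> \<le> 2 * B * infnorm (x - y) powr \<beta> * q ^ k"
    if "x \<in> cbox 0 1" "y \<in> cbox 0 1" for k x y
  proof -
    have "C * (1 + 1 / \<sigma>) \<le> B"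
      unfolding B_def inv(2) using inv(1) \<open>0 \<le> C\<close> by (intro mult_left_mono) linarith+
    then have "C * (1 + 1 / \<sigma>) * (\<sigma> ^ k) powr (\<beta> - 1) * q ^ k * infnorm (x - y)
        \<le> B * (\<sigma> ^ k) powr (\<beta> - 1) * q ^ k * infnorm (x - y)"
      using q by (intro mult_right_mono) (auto simp: infnorm_pos_le)
    then have "\<bar>G k x - G k y\<bar> \<le> (B * q ^ k) * (\<sigma> ^ k) powr (\<beta> - 1) * infnorm (x - y)"
      using G_lip[of k x y] by (simp add: mult_ac)
    moreover have "\<bar>G k x - G k y\<bar> \<le> 2 * ((B * q ^ k) * (\<sigma> ^ k) powr \<beta>)"
      using G_sup[OF that(1), of k] G_sup[OF that(2), of k] by (simp add: mult_ac)
    ultimately have "\<bar>G k x - G k y\<bar> \<le> 2 * (B * q ^ k) * infnorm (x - y) powr \<beta>"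
      using \<beta> \<sigma> B q by (intro multiscale_holder[of \<beta> "\<sigma> ^ k"]) (auto simp: infnorm_pos_le)
    then show ?thesis by (simp add: mult_ac)
  qed

  \<comment> \<open>Summation and bounds for the limit\<close>
  have geo: "summable (\<lambda>k. b * q ^ k)" for b
    using q by (intro summable_mult summable_geometric) auto
  have geo_sum: "(\<Sum>k. b * q ^ k) = b / (1 - q)" for b
    using q by (subst suminf_mult) (auto simp: suminf_geometric)
  have sum_G: "summable (\<lambda>k. G k x)" if "x \<in> cbox 0 1" for x
    by (rule summable_comparison_test'[OF geo[of B], of 0]) (use G_sup'[OF that] in auto)
  have sum_bound: "\<bar>\<Sum>k. a k\<bar> \<le> b / (1 - q)" if "\<And>k. \<bar>a k\<bar> \<le> b * q ^ k" for a b
  proof -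
    have s: "summable (\<lambda>k. \<bar>a k\<bar>)"
      by (rule summable_comparison_test'[OF geo[of b], of 0]) (use that in auto)
    have "\<bar>\<Sum>k. a k\<bar> \<le> (\<Sum>k. \<bar>a k\<bar>)"
      by (rule summable_rabs[OF s])
    also have "\<dots> \<le> (\<Sum>k. b * q ^ k)"
      by (rule suminf_le[OF that s geo])
    finally show ?thesis by (simp add: geo_sum)
  qed
  define g where "g x = F 0 x + (\<Sum>k. G k x)" for x

  have g_holder: "\<bar>g x - g y\<bar> \<le> C * (1 + (4 + 4 / \<sigma>) / (1 - q)) * infnorm (x - y) powr \<beta>"
    if x: "x \<in> cbox 0 1" and y: "y \<in> cbox 0 1" for x y
  proof -
    let ?h = "infnorm (x - y)"
    \<comment> \<open>The unit cube has sup-norm diameter 1, so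
      \<open>?h \<le> ?h powr \<beta>\<close> and the Lipschitz bound for \<open>F 0\<close> becomes
      a Hoelder bound.\<close>
    have "\<bar>vec_nth x i - vec_nth y i\<bar> \<le> 1" for i
    proof -
      have "0 \<le> vec_nth x i" "vec_nth x i \<le> 1" "0 \<le> vec_nth y i" "vec_nth y i \<le> 1"
        using x y by (auto simp: mem_box_cart)
      then show ?thesis by linarith
    qed
    then have h: "?h \<le> 1"
      unfolding infnorm_cart by (intro cSup_least) auto
    have "?h = ?h powr 1"
      by (simp add: infnorm_pos_le)
    also have "\<dots> \<le> ?h powr \<beta>"
      using h \<beta> by (intro powr_mono') (auto simp: infnorm_pos_le)
    finally have "C * ?h \<le> C * ?h powr \<beta>"
      using \<open>0 \<le> C\<close> by (intro mult_left_mono)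
    then have "\<bar>F 0 x - F 0 y\<bar> \<le> C * ?h powr \<beta>"
      using lip[of 0 x y] by simp
    moreover have "(\<Sum>k. G k x) - (\<Sum>k. G k y) = (\<Sum>k. G k x - G k y)"
      by (rule suminf_diff[OF sum_G[OF x] sum_G[OF y]])
    moreover have "\<bar>\<Sum>k. G k x - G k y\<bar> \<le> 2 * B * ?h powr \<beta> / (1 - q)"
      by (rule sum_bound[OF G_holder[OF x y]])
    ultimately have "\<bar>g x - g y\<bar> \<le> C * ?h powr \<beta> + 2 * B * ?h powr \<beta> / (1 - q)"
      by (simp add: g_def)
    also have "2 * B = C * (4 + 4 / \<sigma>)"
      by (simp add: B_def algebra_simps)
    also have "C * ?h powr \<beta> + C * (4 + 4 / \<sigma>) * ?h powr \<beta> / (1 - q)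
        = C * (1 + (4 + 4 / \<sigma>) / (1 - q)) * ?h powr \<beta>"
      by (simp only: distrib_left distrib_right times_divide_eq_right times_divide_eq_left mult_1_right mult.assoc)
    finally show ?thesis .
  qed

  \<comment> \<open>Sampling with \<open>r = 1\<close>: at a good point \<open>y\<close>, the size
    of \<open>f\<close>, its distance to \<open>F 0\<close> and the change of \<open>F 0\<close>
    from \<open>y\<close> to \<open>x\<close> each contribute at most \<open>C\<close>.\<close>
  have F0_sup: "\<bar>F 0 x\<bar> \<le> 3 * C" if x: "x \<in> cbox 0 1" for x
  proof -
    have 1: "measure cube {x \<in> cbox 0 1. C < \<bar>f x\<bar>} < 1 ^ CARD('d) / 2"
      using bounded by simp
    have 2: "measure cube (bad 0) < 1 ^ CARD('d) / 2"
      using close[of 0] by (simp add: bad_def)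
    obtain y where y: "y \<in> cbox 0 1" "y \<notin> {x \<in> cbox 0 1. C < \<bar>f x\<bar>}" "y \<notin> bad 0" "infnorm (y - x) \<le> 1"
      by (rule good_point_near[OF x _ _ measurable_gt_cube[OF f] 1 bad_sets 2]) simp_all
    have "\<bar>F 0 y - F 0 x\<bar> \<le> C * infnorm (y - x)"
      using lip[of 0 y x] by simp
    also have "\<dots> \<le> C * 1"
      using y(4) \<open>0 \<le> C\<close> by (intro mult_left_mono)
    finally show ?thesis
      using y(1,2,3) by (auto simp: bad_def)
  qed
  have g_sup: "\<bar>g x\<bar> \<le> C * (3 + (2 + 2 / \<sigma>) / (1 - q))" if x: "x \<in> cbox 0 1" for x
  proof -
    have "\<bar>g x\<bar> \<le> 3 * C + B / (1 - q)"
      using F0_sup[OF x] sum_bound[OF G_sup'[OF x]] by (simp add: g_def)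
    also have "\<dots> = C * (3 + (2 + 2 / \<sigma>) / (1 - q))"
      by (simp only: B_def distrib_left times_divide_eq_right mult.commute[of C 3])
    finally show ?thesis .
  qed

  \<comment> \<open>Agreement of the limit with the given function almost everywhere\<close>
  have tail: "\<bar>g x - F n x\<bar> \<le> B / (1 - q) * q ^ n" if x: "x \<in> cbox 0 1" for x n
  proof -
    have "F n x = F 0 x + (\<Sum>k<n. G k x)"
      using sum_lessThan_telescope[of "\<lambda>k. F k x" n] by (simp add: G_def)
    then have "g x - F n x = (\<Sum>k. G (k + n) x)"
      using suminf_split_initial_segment[OF sum_G[OF x], of n] by (simp add: g_def)
    moreover have "\<bar>\<Sum>k. G (k + n) x\<bar> \<le> B * q ^ n / (1 - q)"
      using G_sup'[OF x, of "_ + n"] by (intro sum_bound) (simp add: power_add mult_ac)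
    ultimately show ?thesis by simp
  qed

  \<comment> \<open>By uniform convergence of \<open>F n\<close> to \<open>g\<close>, a point where
    \<open>f\<close> and \<open>g\<close> differ by more than \<open>1 / real (Suc m)\<close> lies
    in \<open>bad n\<close> for all large \<open>n\<close>. These sets have measure at most
    \<open>\<sigma> ^ n\<close>, so their intersection is null.\<close>
  have "AE x in cube. \<bar>f x - g x\<bar> \<le> 1 / real (Suc m)" for m
  proof -
    let ?S = "{x \<in> cbox 0 1. 1 / real (Suc m) < \<bar>f x - g x\<bar>}"
    have lim: "(\<lambda>n. (C + B / (1 - q)) * q ^ n) \<longlonglongrightarrow> (C + B / (1 - q)) * 0"
      using q by (intro tendsto_mult tendsto_const LIMSEQ_realpow_zero) auto
    then have "eventually (\<lambda>n. (C + B / (1 - q)) * q ^ n < 1 / real (Suc m)) sequentially"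
      by (rule order_tendstoD(2)) simp
    then obtain n0 where n0: "\<And>n. n0 \<le> n \<Longrightarrow> (C + B / (1 - q)) * q ^ n < 1 / real (Suc m)"
      unfolding eventually_sequentially by blast
    have sub: "?S \<subseteq> bad n" if n: "n0 \<le> n" for n
    proof
      fix x assume x: "x \<in> ?S"
      have "C * (\<sigma> ^ n) powr \<beta> * q ^ n \<le> C * 1 * q ^ n"
        using \<open>0 \<le> C\<close> q \<beta> by (intro mult_right_mono mult_left_mono \<sigma>1) auto
      moreover have "C * q ^ n + B / (1 - q) * q ^ n < \<bar>f x - g x\<bar>"
        using n0[OF n] x by (auto simp: algebra_simps)
      moreover have "\<bar>g x - F n x\<bar> \<le> B / (1 - q) * q ^ n"
        using tail x by blast
      ultimately show "x \<in> bad n"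
        using x by (auto simp: bad_def)
    qed
    have meas_bad: "measure cube (bad n) \<le> \<sigma> ^ n" for n
    proof -
      have "measure cube (bad n) \<le> (\<sigma> ^ n) ^ CARD('d) / 2"
        using close[of n] by (simp add: bad_def)
      also have "\<dots> \<le> (\<sigma> ^ n) ^ CARD('d)"
        using \<sigma> by simp
      also have "\<dots> \<le> (\<sigma> ^ n) ^ 1"
        using \<sigma> by (intro power_decreasing) (auto simp: power_le_one Suc_leI)
      finally show ?thesis by simp
    qed
    let ?N = "\<Inter>n\<in>{n0..}. bad n"
    have N: "?N \<in> sets cube"
      using bad_sets by (intro sets.countable_INT') auto
    have "measure cube ?N \<le> \<sigma> ^ n" if "n0 \<le> n" for n
      using that bad_sets by (intro order_trans[OF finite_measure_mono meas_bad]) auto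
    then have "measure cube ?N \<le> 0"
      using \<sigma> by (intro LIMSEQ_le_const[OF LIMSEQ_realpow_zero[of \<sigma>]]) auto
    then have "?N \<in> null_sets cube"
      using N by (auto simp: null_sets_def emeasure_eq_measure measure_le_0_iff)
    then show ?thesis
      by (rule AE_I') (use sub in \<open>auto simp: not_le\<close>)
  qed
  then have "AE x in cube. \<forall>m. \<bar>f x - g x\<bar> \<le> 1 / real (Suc m)"
    unfolding AE_all_countable by blast
  then have "AE x in cube. g x = f x"
  proof (rule AE_mp, intro AE_I2 impI)
    fix x assume *: "\<forall>m. \<bar>f x - g x\<bar> \<le> 1 / real (Suc m)"
    have "\<bar>f x - g x\<bar> \<le> 0"
      by (rule LIMSEQ_le_const[OF lim_1_over_n[THEN LIMSEQ_Suc]]) (use * in auto)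
    then show "g x = f x" by simp
  qed
  moreover have "g \<in> borel_measurable cube"
    unfolding g_def G_def using F_meas by measurable
  ultimately show ?thesis
    using that g_sup g_holder by blast
qed

subsection \<open>The embedding\<close>

lemma holder_norm_le:
  fixes g :: "real^'d \<Rightarrow> real"
  assumes "g \<in> borel_measurable cube" "0 \<le> M" "0 \<le> H"
    and sup: "\<And>x. x \<in> cbox 0 1 \<Longrightarrow> \<bar>g x\<bar> \<le> M"
    and holder: "\<And>x y. x \<in> cbox 0 1 \<Longrightarrow> y \<in> cbox 0 1 \<Longrightarrow> \<bar>g x - g y\<bar> \<le> H * infnorm (x - y) powr \<beta>"
  shows "holder_norm \<beta> g \<le> ennreal (M + H)"
proof -
  have "Lp_norm \<infinity> g \<le> ennreal M"
    using assms(1) sup by (auto simp: Lp_norm_def intro!: esssup_I AE_I2 ennreal_leI)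
  moreover have "Lip \<beta> g \<le> ennreal H"
    unfolding Lip_def
  proof (rule SUP_least, clarify, rule ennreal_leI)
    fix x y :: "real^'d" assume xy: "x \<in> cbox 0 1" "y \<in> cbox 0 1" "x \<noteq> y"
    then have "0 < infnorm (x - y) powr \<beta>"
      by (simp add: infnorm_eq_0)
    then show "\<bar>g x - g y\<bar> / infnorm (x - y) powr \<beta> \<le> H"
      using holder[OF xy(1,2)] by (simp add: divide_le_eq)
  qed
  ultimately show ?thesis
    unfolding holder_norm_def using assms(2,3) by (simp add: add_mono)
qed

text \<open>An infimum need not be attained; the factor 2 opens a strict gap above the distance, so
  some member of the class lies within it.\<close>

lemma approx_gamma_le_1_near:
  assumes "approx_gamma \<l> c \<alpha> p f \<le> 1" "1 \<le> n"
  obtains g where "g \<in> net_class \<l> c n" "Lp_norm p (\<lambda>x. f x - g x) \<le> ennreal (2 * real n powr - \<alpha>)"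
proof -
  have n: "0 < real n powr \<alpha>"
    using assms(2) by simp
  have "ennreal (real n powr \<alpha>) * Lp_dist p f (net_class \<l> c n) \<le> 1"
    using assms by (auto simp: approx_gamma_def SUP_le_iff)
  then have "ennreal (real n powr - \<alpha>) * (ennreal (real n powr \<alpha>) * Lp_dist p f (net_class \<l> c n))
      \<le> ennreal (real n powr - \<alpha>) * 1"
    by (rule mult_left_mono) simp
  moreover have "ennreal (real n powr - \<alpha>) * ennreal (real n powr \<alpha>) = 1"
    using n by (simp add: powr_minus flip: ennreal_mult)
  ultimately have "Lp_dist p f (net_class \<l> c n) \<le> ennreal (real n powr - \<alpha>)"
    by (simp flip: mult.assoc)
  also have "\<dots> < ennreal (2 * real n powr - \<alpha>)"
    using assms(2) by (simp add: ennreal_less_iff)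
  finally show ?thesis
    using that unfolding Lp_dist_def by (auto simp: INF_less_iff intro: less_imp_le)
qed

text \<open>For \<open>p = \<infinity>\<close> both sides are 0, because \<open>enn2real \<infinity> = 0\<close>.\<close>

lemma of_nat_divide_ennreal:
  assumes "0 < p"
  shows "of_nat k / p = ennreal (real k / enn2real p)"
proof (cases p)
  case (real r)
  then show ?thesis
    using assms by (simp add: ennreal_of_nat_eq_real_of_nat divide_ennreal)
qed simp

text \<open>The exponents are fixed before \<open>f\<close>, so one constant serves the whole unit
  ball. The bounds are stated pointwise, a form that passes easily through rescaling.\<close>

lemma approx_unit_ball_holder:
  fixes \<beta> \<alpha> :: real and p :: ennreal and \<l> c :: "nat \<Rightarrow> enat"
  assumes \<beta>: "0 < \<beta>" "\<beta> < 1" and p: "0 < p"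
    and \<l>: "\<And>n. 1 \<le> n \<Longrightarrow> 2 \<le> \<l> n"
    and c: "\<And>n. 1 \<le> n \<Longrightarrow> 1 \<le> c n" "mono_on {1..} c"
    and fin: "gamma_star \<l> c < \<infinity>"
    and \<alpha>: "(ennreal \<beta> + of_nat CARD('d) / p) / ennreal (1 - \<beta>) * gamma_star \<l> c < ennreal \<alpha>"
  obtains C where "0 < C"
    "\<And>f :: real^'d \<Rightarrow> real. f \<in> borel_measurable cube \<Longrightarrow> approx_gamma \<l> c \<alpha> p f \<le> 1 \<Longrightarrow>
       \<exists>g. g \<in> borel_measurable cube \<and> (AE x in cube. g x = f x) \<and>
         (\<forall>x\<in>cbox 0 1. \<bar>g x\<bar> \<le> C) \<and>
         (\<forall>x\<in>cbox 0 1. \<forall>y\<in>cbox 0 1. \<bar>g x - g y\<bar> \<le> C * infnorm (x - y) powr \<beta>)"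
proof -
  define \<delta> where "\<delta> = CARD('d) / enn2real p"
  have \<delta>: "0 \<le> \<delta>"
    by (simp add: \<delta>_def)
  obtain \<gamma>s where \<gamma>s: "gamma_star \<l> c = ennreal \<gamma>s" "0 \<le> \<gamma>s"
    using fin by (cases "gamma_star \<l> c") auto
  have "ennreal ((\<beta> + \<delta>) / (1 - \<beta>)) * ennreal \<gamma>s < ennreal \<alpha>"
    using \<alpha> \<gamma>s \<beta> \<delta>
    by (simp add: of_nat_divide_ennreal[OF p] divide_ennreal
        flip: \<delta>_def ennreal_plus)
  then have "ennreal ((\<beta> + \<delta>) / (1 - \<beta>) * \<gamma>s) < ennreal \<alpha>"
    using \<gamma>s \<beta> \<delta> by (subst ennreal_mult) auto
  then have "(\<beta> + \<delta>) / (1 - \<beta>) * \<gamma>s < \<alpha>"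
    using \<gamma>s \<beta> \<delta> by (simp add: ennreal_less_iff)
  then have "\<gamma>s < \<alpha> * (1 - \<beta>) / (\<beta> + \<delta>)"
    using \<beta> \<delta> by (simp add: field_simps)
  \<comment> \<open>The strict hypothesis leaves room twice: first for \<gamma> above the complexity
    exponent, then for the scale exponent \<rho>.\<close>
  then obtain \<gamma> where \<gamma>: "\<gamma>s < \<gamma>" "\<gamma> < \<alpha> * (1 - \<beta>) / (\<beta> + \<delta>)"
    using dense by blast
  then have "\<gamma> / (1 - \<beta>) < \<alpha> / (\<beta> + \<delta>)"
    using \<beta> \<delta> by (simp add: field_simps)
  then obtain \<rho> where \<rho>: "\<gamma> / (1 - \<beta>) < \<rho>" "\<rho> < \<alpha> / (\<beta> + \<delta>)"
    using dense by blast
  have \<rho>0: "0 < \<rho>"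
    using \<rho>(1) \<gamma>(1) \<gamma>s(2) \<beta> by (meson divide_nonneg_pos diff_gt_0_iff_gt le_less_trans less_imp_le order.trans)
  \<comment> \<open>The slack in the exponents of the slope bound and of the sampling bound; the
    smaller one sets the decay rate \<open>q\<close>.\<close>
  define e where "e = min (\<rho> * (1 - \<beta>) - \<gamma>) (\<alpha> - \<rho> * (\<beta> + \<delta>))"
  have e: "0 < e" "e \<le> \<rho> * (1 - \<beta>) - \<gamma>" "e \<le> \<alpha> - \<rho> * (\<beta> + \<delta>)"
    using \<rho> \<beta> \<delta> by (auto simp: e_def field_simps)
  define \<sigma> q :: real where "\<sigma> = 2 powr - \<rho>" and "q = 2 powr - e"
  have \<sigma>: "0 < \<sigma>" "\<sigma> < 1" and q: "0 < q" "q < 1"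
    using \<rho>0 e by (simp_all add: \<sigma>_def q_def powr_less_one)
  have \<sigma>_powr: "(\<sigma> ^ k) powr s = (2 powr (- \<rho> * s)) ^ k" for k s
    by (simp add: \<sigma>_def powr_powr powr_power mult_ac)
  have two_powr: "real (2 ^ k) powr s = (2 powr s) ^ k" for k s
    by (simp add: powr_powr powr_power mult_ac flip: powr_realpow)

  obtain K where K: "0 < K"
    "\<And>n (g :: real^'d \<Rightarrow> real) x y. 1 \<le> n \<Longrightarrow> g \<in> net_class \<l> c n \<Longrightarrow>
       \<bar>g x - g y\<bar> \<le> K * real n powr \<gamma> * infnorm (x - y)"
    using net_class_uniform_lipschitz[where \<gamma> = \<gamma> and \<l> = \<l> and c = c, OF \<l> c] \<gamma>s \<gamma>(1) by (auto simp: ennreal_less_iff)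
  obtain K' where K': "0 < K'"
    "\<And>(h :: real^'d \<Rightarrow> real) \<epsilon> r. h \<in> borel_measurable cube \<Longrightarrow> Lp_norm p h \<le> ennreal \<epsilon> \<Longrightarrow>
      0 < \<epsilon> \<Longrightarrow> 0 < r \<Longrightarrow> r \<le> 1 \<Longrightarrow>
      measure cube {x \<in> cbox 0 1. K' * \<epsilon> * r powr - \<delta> < \<bar>h x\<bar>} < r ^ CARD('d) / 2"
    using Lp_norm_Markov[OF p] unfolding \<delta>_def by blast
  \<comment> \<open>\<open>K\<close> serves the slopes, and \<open>2 * K'\<close> serves the
    sampling error, the 2 coming from the near-best choice of approximants.\<close>
  define C where "C = max K (2 * K')"
  have C: "0 < C" "K \<le> C" "2 * K' \<le> C"
    using K(1) by (auto simp: C_def)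
  define D where "D = C * (3 + (4 + 4 / \<sigma>) / (1 - q))"
  have D: "0 < D" "C * (3 + (2 + 2 / \<sigma>) / (1 - q)) \<le> D" "C * (1 + (4 + 4 / \<sigma>) / (1 - q)) \<le> D"
    unfolding D_def using C \<sigma> q
    by (auto intro!: mult_pos_pos add_pos_pos mult_left_mono add_mono divide_right_mono divide_pos_pos)

  interpret finite_measure "cube :: (real^'d) measure"
    by (rule finite_measure_cube)
  have "\<exists>g. g \<in> borel_measurable cube \<and> (AE x in cube. g x = f x) \<and>
         (\<forall>x\<in>cbox 0 1. \<bar>g x\<bar> \<le> D) \<and>
         (\<forall>x\<in>cbox 0 1. \<forall>y\<in>cbox 0 1. \<bar>g x - g y\<bar> \<le> D * infnorm (x - y) powr \<beta>)"
    if f: "f \<in> borel_measurable cube" and gam: "approx_gamma \<l> c \<alpha> p f \<le> 1" for f :: "real^'d \<Rightarrow> real"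
  proof -
    have "\<exists>g. g \<in> net_class \<l> c (2 ^ k) \<and> Lp_norm p (\<lambda>x. f x - g x) \<le> ennreal (2 * real (2 ^ k) powr - \<alpha>)" for k
      using approx_gamma_le_1_near[OF gam, of "2 ^ k"] by (metis one_le_numeral one_le_power)
    then obtain F where F: "\<And>k. F k \<in> net_class \<l> c (2 ^ k)"
      and Fp: "\<And>k. Lp_norm p (\<lambda>x. f x - F k x) \<le> ennreal (2 * real (2 ^ k) powr - \<alpha>)"
      by metis
    have lip: "\<bar>F k x - F k y\<bar> \<le> C * (\<sigma> ^ k) powr (\<beta> - 1) * q ^ k * infnorm (x - y)" for k x y
    proof -
      \<comment> \<open>This is \<open>\<gamma> \<le> \<rho> * (1 - \<beta>) - e\<close> in
        exponential form; its \<open>k\<close>-th power is the slope estimate at level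
        \<open>k\<close>.\<close>
      have "2 powr \<gamma> \<le> 2 powr (- \<rho> * (\<beta> - 1)) * q"
        using e(2) unfolding q_def by (simp add: algebra_simps flip: powr_add)
      then have "K * (2 powr \<gamma>) ^ k \<le> C * (2 powr (- \<rho> * (\<beta> - 1)) * q) ^ k"
        by (rule mult_mono[OF C(2) power_mono]) (use C q in auto)
      then have "K * real (2 ^ k) powr \<gamma> \<le> C * (\<sigma> ^ k) powr (\<beta> - 1) * q ^ k"
        unfolding two_powr \<sigma>_powr by (simp add: power_mult_distrib mult.assoc)
      then show ?thesis
        by (intro order_trans[OF K(2)[OF _ F] mult_right_mono]) (auto simp: infnorm_pos_le)
    qed
    have meas: "(\<lambda>x. f x - F k x) \<in> borel_measurable cube" for k
      by (intro borel_measurable_diff f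
          borel_measurable_cube_continuous[OF infnorm_lipschitz_continuous[OF lip]])
    have close: "measure cube {x \<in> cbox 0 1. C * (\<sigma> ^ k) powr \<beta> * q ^ k < \<bar>f x - F k x\<bar>}
      < (\<sigma> ^ k) ^ CARD('d) / 2" for k
    proof -
      \<comment> \<open>This is \<open>e \<le> \<alpha> - \<rho> * (\<beta> + \<delta>)\<close> in
        exponential form, where \<open>\<rho> * \<delta>\<close> is the price of sampling in cubes
        of side \<open>\<sigma> ^ k\<close>.\<close>
      have "2 powr - \<alpha> * 2 powr (- \<rho> * - \<delta>) \<le> 2 powr (- \<rho> * \<beta>) * q"
        using e(3) unfolding q_def by (simp add: algebra_simps flip: powr_add)
      then have "(2 * K') * (2 powr - \<alpha> * 2 powr (- \<rho> * - \<delta>)) ^ k \<le> C * (2 powr (- \<rho> * \<beta>) * q) ^ k"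
        by (rule mult_mono[OF C(3) power_mono]) (use C q in auto)
      then have *: "K' * (2 * real (2 ^ k) powr - \<alpha>) * (\<sigma> ^ k) powr - \<delta> \<le> C * (\<sigma> ^ k) powr \<beta> * q ^ k"
        unfolding two_powr \<sigma>_powr by (simp add: power_mult_distrib mult_ac)
      have "measure cube {x \<in> cbox 0 1. C * (\<sigma> ^ k) powr \<beta> * q ^ k < \<bar>f x - F k x\<bar>}
        \<le> measure cube {x \<in> cbox 0 1. K' * (2 * real (2 ^ k) powr - \<alpha>) * (\<sigma> ^ k) powr - \<delta> < \<bar>f x - F k x\<bar>}"
        using * by (intro finite_measure_mono measurable_gt_cube meas) auto
      also have "\<dots> < (\<sigma> ^ k) ^ CARD('d) / 2"
        using \<sigma> by (intro K'(2) meas Fp) (auto simp: power_le_one)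
      finally show ?thesis .
    qed
    have "Lp_norm p f \<le> ennreal 1"
      using gam by (simp add: approx_gamma_def)
    then have "measure cube {x \<in> cbox 0 1. K' * 1 * 1 powr - \<delta> < \<bar>f x\<bar>} < 1 ^ CARD('d) / 2"
      using f by (intro K'(2)) auto
    moreover have "measure cube {x \<in> cbox 0 1. C < \<bar>f x\<bar>}
        \<le> measure cube {x \<in> cbox 0 1. K' * 1 * 1 powr - \<delta> < \<bar>f x\<bar>}"
      using C K' by (intro finite_measure_mono measurable_gt_cube f) auto
    ultimately have bounded: "measure cube {x \<in> cbox 0 1. C < \<bar>f x\<bar>} < 1 / 2"
      by simp
    obtain g where g: "g \<in> borel_measurable cube" "AE x in cube. g x = f x"
      "\<And>x. x \<in> cbox 0 1 \<Longrightarrow> \<bar>g x\<bar> \<le> C * (3 + (2 + 2 / \<sigma>) / (1 - q))"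
      "\<And>x y. x \<in> cbox 0 1 \<Longrightarrow> y \<in> cbox 0 1 \<Longrightarrow>
        \<bar>g x - g y\<bar> \<le> C * (1 + (4 + 4 / \<sigma>) / (1 - q)) * infnorm (x - y) powr \<beta>"
      using multiscale_limit[OF \<beta> q \<sigma> less_imp_le[OF C(1)] f lip close bounded] by blast
    have "\<bar>g x\<bar> \<le> D" if "x \<in> cbox 0 1" for x
      using g(3)[OF that] D(2) by (rule order_trans)
    moreover have "\<bar>g x - g y\<bar> \<le> D * infnorm (x - y) powr \<beta>" if "x \<in> cbox 0 1" "y \<in> cbox 0 1" for x y
      by (rule order_trans[OF g(4)[OF that] mult_right_mono[OF D(3)]]) simp
    ultimately show ?thesis
      using g(1,2) by blast
  qed
  with D(1) that show ?thesis by blast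
qed

text \<open>Homogeneity reduces the claim to the unit ball: divide \<open>f\<close> by an admissible
  \<open>t\<close> close to its norm, apply the bound there, and multiply back.\<close>

theorem theorem3p5:
  fixes \<beta> \<alpha> :: real and p :: ennreal and \<l> c :: "nat \<Rightarrow> enat"
  assumes "0 < \<beta>" and "\<beta> < 1" and "0 < p" and "0 < \<alpha>"
    and "\<And>n. 1 \<le> n \<Longrightarrow> 2 \<le> \<l> n" and "mono_on {1..} \<l>"
    and "\<And>n. 1 \<le> n \<Longrightarrow> 1 \<le> c n" and "mono_on {1..} c"
    and "gamma_star \<l> c < \<infinity>"
    and "(ennreal \<beta> + of_nat CARD('d) / p) / ennreal (1 - \<beta>) * gamma_star \<l> c < ennreal \<alpha>"
  shows "embeds (approx_space \<l> c \<alpha> p :: (real^'d \<Rightarrow> real) set) (approx_norm \<l> c \<alpha> p)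
           (holder_space \<beta>) (holder_norm \<beta>)"
proof -
  obtain C where C: "0 < C"
    and ball: "\<And>f :: real^'d \<Rightarrow> real. f \<in> borel_measurable cube \<Longrightarrow> approx_gamma \<l> c \<alpha> p f \<le> 1 \<Longrightarrow>
       \<exists>g. g \<in> borel_measurable cube \<and> (AE x in cube. g x = f x) \<and>
         (\<forall>x\<in>cbox 0 1. \<bar>g x\<bar> \<le> C) \<and>
         (\<forall>x\<in>cbox 0 1. \<forall>y\<in>cbox 0 1. \<bar>g x - g y\<bar> \<le> C * infnorm (x - y) powr \<beta>)"
    using approx_unit_ball_holder[OF assms(1-3,5,7-10)] by blast
  \<comment> \<open>The Hoelder norm collects \<open>t * C\<close> from the sup part and
    \<open>t * C\<close> from the seminorm. The pointwise bound is kept for functions of norm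
    0.\<close>
  have scaled: "\<exists>g. g \<in> borel_measurable cube \<and> (AE x in cube. g x = f x) \<and>
         (\<forall>x\<in>cbox 0 1. \<bar>g x\<bar> \<le> t * C) \<and> holder_norm \<beta> g \<le> ennreal (2 * C * t)"
    if f: "f \<in> borel_measurable cube" and t: "0 < t" "approx_gamma \<l> c \<alpha> p (\<lambda>x. f x / t) \<le> 1"
    for f :: "real^'d \<Rightarrow> real" and t
  proof -
    have "(\<lambda>x. f x / t) \<in> borel_measurable cube"
      using f by measurable
    from ball[OF this t(2)] obtain g where g: "g \<in> borel_measurable cube" "AE x in cube. g x = f x / t"
      "\<And>x. x \<in> cbox 0 1 \<Longrightarrow> \<bar>g x\<bar> \<le> C"
      "\<And>x y. x \<in> cbox 0 1 \<Longrightarrow> y \<in> cbox 0 1 \<Longrightarrow> \<bar>g x - g y\<bar> \<le> C * infnorm (x - y) powr \<beta>"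
      by blast
    have 1: "(\<lambda>x. t * g x) \<in> borel_measurable cube"
      using g(1) by measurable
    have 2: "\<bar>t * g x\<bar> \<le> t * C" if "x \<in> cbox 0 1" for x
      using g(3)[OF that] t(1) by (simp add: abs_mult)
    have "\<bar>t * g x - t * g y\<bar> \<le> t * C * infnorm (x - y) powr \<beta>" if "x \<in> cbox 0 1" "y \<in> cbox 0 1" for x y
      using mult_left_mono[OF g(4)[OF that], of t] t(1)
      by (simp add: abs_mult mult.assoc flip: right_diff_distrib)
    then have "holder_norm \<beta> (\<lambda>x. t * g x) \<le> ennreal (t * C + t * C)"
      using t(1) C by (intro holder_norm_le 1 2) auto
    moreover have "AE x in cube. t * g x = f x"
      using g(2) by (rule AE_mp) (use t(1) in auto)
    ultimately show ?thesis
      using 1 2 by (intro exI[of _ "\<lambda>x. t * g x"]) (auto simp: mult_ac)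
  qed
  have "\<exists>g\<in>holder_space \<beta>. (AE x in cube. g x = f x) \<and> holder_norm \<beta> g \<le> ennreal (4 * C) * approx_norm \<l> c \<alpha> p f"
    if "f \<in> approx_space \<l> c \<alpha> p" for f :: "real^'d \<Rightarrow> real"
  proof -
    have f: "f \<in> borel_measurable cube" and "approx_norm \<l> c \<alpha> p f < \<infinity>"
      using that by (auto simp: approx_space_def Lp_space_def)
    then obtain t0 where t0: "approx_norm \<l> c \<alpha> p f = ennreal t0" "0 \<le> t0"
      by (cases "approx_norm \<l> c \<alpha> p f") auto
    have near: "\<exists>t. 0 < t \<and> t < s \<and> approx_gamma \<l> c \<alpha> p (\<lambda>x. f x / t) \<le> 1" if "t0 < s" for s
    proof -
      have "approx_norm \<l> c \<alpha> p f < ennreal s"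
        using that t0 by (simp add: ennreal_less_iff)
      then show ?thesis
        unfolding approx_norm_def by (auto simp: INF_less_iff ennreal_less_iff)
    qed
    show ?thesis
    proof (cases "t0 = 0")
      case False
      \<comment> \<open>The infimum defining the norm need not be attained; an admissible
        \<open>t\<close> below twice its positive value suffices and accounts for the final constant
        \<open>4 * C\<close>.\<close>
      with t0 near[of "2 * t0"] obtain t where t: "0 < t" "t < 2 * t0" "approx_gamma \<l> c \<alpha> p (\<lambda>x. f x / t) \<le> 1"
        by auto
      from scaled[OF f t(1,3)] obtain g where g: "AE x in cube. g x = f x" "holder_norm \<beta> g \<le> ennreal (2 * C * t)"
        by blast
      note g(2)
      also have "ennreal (2 * C * t) \<le> ennreal (4 * C * t0)"
        using t C by (intro ennreal_leI) auto
      also have "\<dots> = ennreal (4 * C) * approx_norm \<l> c \<alpha> p f"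
        using t0 C by (simp add: ennreal_mult)
      finally have "holder_norm \<beta> g \<le> ennreal (4 * C) * approx_norm \<l> c \<alpha> p f" .
      moreover have "g \<in> holder_space \<beta>"
        using le_less_trans[OF g(2) ennreal_less_top] by (simp add: holder_space_def)
      ultimately show ?thesis
        using g(1) by blast
    next
      case True
      \<comment> \<open>Norm 0 provides arbitrarily small admissible \<open>t\<close>, so
        \<open>f\<close> vanishes almost everywhere and the zero function represents it.\<close>
      have "AE x in cube. \<bar>f x\<bar> \<le> C / real (Suc m)" for m
      proof -
        obtain t where t: "0 < t" "t < 1 / real (Suc m)" "approx_gamma \<l> c \<alpha> p (\<lambda>x. f x / t) \<le> 1"
          using near[of "1 / real (Suc m)"] True by auto
        from scaled[OF f t(1,3)] obtain g where g: "AE x in cube. g x = f x"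
          "\<And>x. x \<in> cbox 0 1 \<Longrightarrow> \<bar>g x\<bar> \<le> t * C"
          by blast
        have "t * C \<le> C / real (Suc m)"
          using mult_right_mono[of t "1 / real (Suc m)" C] t(2) C by simp
        from order_trans[OF g(2) this] have "AE x in cube. \<bar>g x\<bar> \<le> C / real (Suc m)"
          by (intro AE_I2) simp
        with g(1) show ?thesis
          by eventually_elim simp
      qed
      then have "AE x in cube. \<forall>m. \<bar>f x\<bar> \<le> C / real (Suc m)"
        unfolding AE_all_countable by blast
      then have "AE x in cube. 0 = f x"
      proof (rule AE_mp, intro AE_I2 impI)
        fix x assume *: "\<forall>m. \<bar>f x\<bar> \<le> C / real (Suc m)"
        have "(\<lambda>m. C / real (Suc m)) \<longlonglongrightarrow> 0"
          by (rule LIMSEQ_Suc[OF lim_const_over_n])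
        then have "\<bar>f x\<bar> \<le> 0"
          by (rule LIMSEQ_le_const) (use * in auto)
        then show "0 = f x" by simp
      qed
      moreover have "holder_norm \<beta> (\<lambda>x :: real^'d. 0) \<le> ennreal (0 + 0)"
        by (rule holder_norm_le) auto
      ultimately show ?thesis
        by (intro bexI[of _ "\<lambda>x. 0"]) (auto simp: holder_space_def)
    qed
  qed
  then show ?thesis
    unfolding embeds_def using C by (intro exI[of _ "4 * C"]) auto
qed

end
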